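(* Fix an integer $m\ge1$ and a set $I$ with $\{(i,j,0): i+j=m\}\cup\{(0,0,m)\}\subset I\subset\mathcal M_{3,m}$. For $f(x,y)\in\mathbb{Z}[x,y]$ of degree $m$ let $F(x,y,z)=z^mf(x/z,y/z)$, let $I_f$ be the set of exponent vectors of monomials of $F$ having nonzero coefficient, and let $C_f$ be the projective curve $F=0$. Then for a positive proportion of $f(x,y)\in\mathbb{Z}[x,y]$ of degree $m$ with $I_f=I$ (ordered by the maximum absolute value of their coefficients, i.e. with positive lower density as this bound tends to infinity) we have $G(C_f)=m=G(H)$, where $H=\{(0,0,m),(0,m,0),(m,0,0)\}$ is the Newton polytope of every such $f$.
   Context: $\mathcal M_{3,m}=\{(i,j,k)\in\mathbb{Z}^3_{\ge0}: i+j+k=m\}$. $G(H)$ is the gcd of all coordinates of all elements of $H$. For a number field $L$, a point of $C_f$ over $L$ is new if it is non-singular and not defined over a proper subfield of $L$; $D(C_f)$ is the set of degrees $[L:\mathbb{Q}]$ of number fields $L$ over which $C_f$ has a new point, and $G(C_f)=\gcd D(C_f)$ is the index. *)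

theory Defs
  imports Complex_Main
begin

type_synonym expo = "nat \<times> nat \<times> nat"

definition M3 :: "nat \<Rightarrow> expo set" where
  "M3 m = {(i,j,k). i + j + k = m}"

definition Gidx :: "expo set \<Rightarrow> nat" where
  "Gidx H = Gcd (\<Union>(i,j,k)\<in>H. {i,j,k})"

text \<open>A polynomial f of degree m in Z[x,y] is represented by its homogenisation
  F(x,y,z) = z^m f(x/z,y/z), i.e. by an integer coefficient function on exponent
  vectors (i,j,k) with i+j+k = m. The following evaluate F and its partials.\<close>
definition homF :: "nat \<Rightarrow> (expo \<Rightarrow> int) \<Rightarrow> complex \<Rightarrow> complex \<Rightarrow> complex \<Rightarrow> complex" where
  "homF m c x y z = (\<Sum>(i,j,k)\<in>M3 m. of_int (c (i,j,k)) * x^i * y^j * z^k)"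

definition homFx :: "nat \<Rightarrow> (expo \<Rightarrow> int) \<Rightarrow> complex \<Rightarrow> complex \<Rightarrow> complex \<Rightarrow> complex" where
  "homFx m c x y z = (\<Sum>(i,j,k)\<in>M3 m. of_int (c (i,j,k)) * of_nat i * x^(i-1) * y^j * z^k)"

definition homFy :: "nat \<Rightarrow> (expo \<Rightarrow> int) \<Rightarrow> complex \<Rightarrow> complex \<Rightarrow> complex \<Rightarrow> complex" where
  "homFy m c x y z = (\<Sum>(i,j,k)\<in>M3 m. of_int (c (i,j,k)) * of_nat j * x^i * y^(j-1) * z^k)"

definition homFz :: "nat \<Rightarrow> (expo \<Rightarrow> int) \<Rightarrow> complex \<Rightarrow> complex \<Rightarrow> complex \<Rightarrow> complex" where
  "homFz m c x y z = (\<Sum>(i,j,k)\<in>M3 m. of_int (c (i,j,k)) * of_nat k * x^i * y^j * z^(k-1))"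

text \<open>Subfields of C (number fields are realised inside C).\<close>
definition is_subfield :: "complex set \<Rightarrow> bool" where
  "is_subfield K \<longleftrightarrow> 0 \<in> K \<and> 1 \<in> K \<and>
     (\<forall>a\<in>K. \<forall>b\<in>K. a + b \<in> K \<and> a * b \<in> K) \<and> (\<forall>a\<in>K. - a \<in> K) \<and>
     (\<forall>a\<in>K. a \<noteq> 0 \<longrightarrow> inverse a \<in> K)"

definition field_degree :: "complex set \<Rightarrow> nat \<Rightarrow> bool" where
  "field_degree L n \<longleftrightarrow> (\<exists>B. finite B \<and> card B = n \<and> B \<subseteq> L \<and>
     (\<forall>q :: complex \<Rightarrow> rat. (\<Sum>b\<in>B. of_rat (q b) * b) = 0 \<longrightarrow> (\<forall>b\<in>B. q b = 0)) \<and>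
     L = {\<Sum>b\<in>B. of_rat (q b) * b | q :: complex \<Rightarrow> rat. True})"

definition new_point :: "nat \<Rightarrow> (expo \<Rightarrow> int) \<Rightarrow> complex set \<Rightarrow> complex \<Rightarrow> complex \<Rightarrow> complex \<Rightarrow> bool" where
  "new_point m c L x y z \<longleftrightarrow>
     x \<in> L \<and> y \<in> L \<and> z \<in> L \<and> (x, y, z) \<noteq> (0, 0, 0) \<and>
     homF m c x y z = 0 \<and>
     (homFx m c x y z, homFy m c x y z, homFz m c x y z) \<noteq> (0, 0, 0) \<and>
     \<not> (\<exists>K t. is_subfield K \<and> K \<subset> L \<and> t \<noteq> 0 \<and> t * x \<in> K \<and> t * y \<in> K \<and> t * z \<in> K)"

definition degset :: "nat \<Rightarrow> (expo \<Rightarrow> int) \<Rightarrow> nat set" where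
  "degset m c = {n. \<exists>L. is_subfield L \<and> field_degree L n \<and> (\<exists>x y z. new_point m c L x y z)}"

definition curve_index :: "nat \<Rightarrow> (expo \<Rightarrow> int) \<Rightarrow> nat" where
  "curve_index m c = Gcd (degset m c)"

definition family :: "expo set \<Rightarrow> nat \<Rightarrow> (expo \<Rightarrow> int) set" where
  "family I B = {c. (\<forall>e. c e \<noteq> 0 \<longleftrightarrow> e \<in> I) \<and> (\<forall>e. \<bar>c e\<bar> \<le> int B)}"

end

theory Submission
  imports Defs "Jordan_Normal_Form.Schur_Decomposition"
    "HOL-Computational_Algebra.Fundamental_Theorem_Algebra" "HOL-Number_Theory.Cong"
begin

text \<open>Suppose that $c_{m00} \equiv 1$ mod 3, $c_{0m0} \equiv 3$ mod 9, $c_{00m} \equiv 9$ mod 27 and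
  that 9 divides the other coefficients; this holds with positive density. Fix a valuation ring of
  the complex numbers in which 3 is not a unit. After scaling $y$ and $z$ by $3^{1/m}$ and $3^{2/m}$,
  each embedding of $L$ reduces a point over $L$ to a nonzero solution of $X^m + Y^m + Z^m = 0$ over
  the residue field, so exactly one of $XY \neq 0$, $X = 0$, $Y = 0$ holds. Each of these classes of
  embeddings is read off from the reduction of $a / 3^{s/b}$ for a quotient $a$ of coordinates. The
  characteristic polynomial of $a$ is rational, hence that of $a / 3^{s/b}$ reduces to
  $T^r Q(T^b)$ with $Q$ over the prime field, and the number of embeddings in the class is divisible
  by $m$. If $m$ is even, the class $Y = 0$ only has $b = m/2$; the missing factor 2 comes from
  $-1$ being a nonsquare mod 3. So $m$ divides $[L : Q]$. Conversely, a root of $F(T, 1, 0)$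
  generates a field of degree at most $m$, hence of degree $m$.\<close>

section \<open>Embeddings of number fields\<close>

text \<open>The weights 0, 1/m, 2/m give x/y, y/z and x/z the fractional valuations 1/m, 1/m, 2/m
  whenever the two scaled coordinates involved are units, and the denominator then divides the
  number of such embeddings like a ramification index. With integral weights 0, a, b over m, one of
  a, b, b - a is even, so for even m some class always loses a factor 2. The prime 3 is chosen
  because T^2 + 1 is irreducible over its prime field: a residue extension restores the factor. The
  same prime serves all m, multiples of 3 included, because roots are counted with multiplicity and
  repeated roots do no harm. Instead of all valuations of L above 3, one valuation ring of the
  complex numbers is fixed and L is moved by its n embeddings. The obstacle is to have these as a
  single list that serves all elements of L at once and makes every product of the T - h_i(a)
  rational. It is obtained from the commuting matrices of multiplication; the list is indexed by i <
  n, and counting indices is all that is done with it.\<close>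

definition rational_embedding :: "complex set \<Rightarrow> (complex \<Rightarrow> complex) \<Rightarrow> bool" where
  "rational_embedding L h \<longleftrightarrow> h 1 = 1 \<and>
     (\<forall>a\<in>L. \<forall>b\<in>L. h (a + b) = h a + h b \<and> h (a * b) = h a * h b) \<and>
     (\<forall>a\<in>L. \<forall>q. h (of_rat q * a) = of_rat q * h a)"

text \<open>The dimension \<open>n\<close> is independent of the degree of \<open>L\<close>, because
  the induction passes from the regular representation to quotients of smaller dimension.\<close>

definition matrix_rep :: "complex set \<Rightarrow> nat \<Rightarrow> (complex \<Rightarrow> complex mat) \<Rightarrow> bool" where
  "matrix_rep L n \<rho> \<longleftrightarrow> (\<forall>a\<in>L. \<rho> a \<in> carrier_mat n n) \<and> \<rho> 1 = 1\<^sub>m n \<and>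
     (\<forall>a\<in>L. \<forall>b\<in>L. \<rho> (a + b) = \<rho> a + \<rho> b \<and> \<rho> (a * b) = \<rho> a * \<rho> b) \<and>
     (\<forall>a\<in>L. \<forall>q. \<rho> (of_rat q * a) = of_rat q \<cdot>\<^sub>m \<rho> a)"

lemma subfield_of_rat:
  assumes "is_subfield L"
  shows "of_rat q \<in> L"
proof -
  have nat: "of_nat n \<in> L" for n
    using assms by (induction n) (auto simp: is_subfield_def)
  have int: "of_int k \<in> L" for k
    using nat assms by (cases k rule: int_cases2) (auto simp: is_subfield_def)
  obtain a b where q: "quotient_of q = (a, b)" by force
  have "q = of_int a / of_int b" using quotient_of_div[OF q] .
  hence "(of_rat q :: complex) = of_int a * inverse (of_int b)"
    by (simp add: of_rat_divide of_rat_of_int_eq flip: divide_inverse)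
  moreover have "b \<noteq> 0" using quotient_of_denom_pos[OF q] by simp
  hence "inverse (of_int b :: complex) \<in> L" using int[of b] assms by (auto simp: is_subfield_def)
  ultimately show ?thesis using int[of a] assms by (auto simp: is_subfield_def)
qed

section \<open>Polynomials in a matrix applied to a vector\<close>

definition poly_act :: "complex mat \<Rightarrow> complex vec \<Rightarrow> complex poly \<Rightarrow> complex vec" where
  "poly_act A v p = fold_coeffs (\<lambda>a u. a \<cdot>\<^sub>v v + A *\<^sub>v u) p (0\<^sub>v (dim_vec v))"

context
  fixes A :: "complex mat" and v :: "complex vec" and n :: nat
  assumes A: "A \<in> carrier_mat n n" and v: "v \<in> carrier_vec n"
begin

lemma poly_act_0: "poly_act A v 0 = 0\<^sub>v n"
  using v by (simp add: poly_act_def)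

text \<open>Horner's rule gives p(A) v without matrix powers, and inductions run along
  \<open>pCons\<close>. The zero case is separate because \<open>fold_coeffs\<close> makes no step
  for \<open>pCons 0 0\<close>, which is the zero polynomial.\<close>

lemma poly_act_pCons: "poly_act A v (pCons a p) = a \<cdot>\<^sub>v v + A *\<^sub>v poly_act A v p"
proof (cases "p = 0 \<and> a = 0")
  case True
  have "A *\<^sub>v 0\<^sub>v n = 0\<^sub>v n" using A by (intro eq_vecI) auto
  moreover have "0 \<cdot>\<^sub>v v = 0\<^sub>v n" using v by (intro eq_vecI) auto
  ultimately show ?thesis using True by (simp add: poly_act_0)
next
  case False
  thus ?thesis by (auto simp: poly_act_def)
qed

lemma poly_act_closed: "poly_act A v p \<in> carrier_vec n"
  using A v by (induction p) (auto simp: poly_act_0 poly_act_pCons)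

lemma poly_act_add: "poly_act A v (p + q) = poly_act A v p + poly_act A v q"
proof (induction p q rule: poly_induct2)
  case 0
  show ?case by (simp add: poly_act_0)
next
  case (pCons a p b q)
  have c: "poly_act A v p \<in> carrier_vec n" "poly_act A v q \<in> carrier_vec n"
    by (auto simp: poly_act_closed)
  have "poly_act A v (pCons a p + pCons b q)
      = (a + b) \<cdot>\<^sub>v v + A *\<^sub>v (poly_act A v p + poly_act A v q)"
    by (simp add: poly_act_pCons pCons)
  also have "\<dots> = (a \<cdot>\<^sub>v v + b \<cdot>\<^sub>v v) + (A *\<^sub>v poly_act A v p + A *\<^sub>v poly_act A v q)"
    using A c v by (simp add: mult_add_distrib_mat_vec add_smult_distrib_vec)
  also have "\<dots> = poly_act A v (pCons a p) + poly_act A v (pCons b q)"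
    unfolding poly_act_pCons using A c v
    by (intro eq_vecI) auto
  finally show ?case .
qed

lemma poly_act_smult: "poly_act A v (smult c p) = c \<cdot>\<^sub>v poly_act A v p"
proof (induction p)
  case 0
  show ?case by (auto simp: poly_act_0 intro!: eq_vecI)
next
  case (pCons a p)
  have c: "poly_act A v p \<in> carrier_vec n" by (rule poly_act_closed)
  show ?case
    using A c v by (simp add: poly_act_pCons pCons mult_mat_vec smult_add_distrib_vec smult_smult_assoc)
qed

text \<open>This is T p = (T - e) p + e p. If (T - e) p kills \<open>v\<close> and p does not, then
  p(A) v is an eigenvector of \<open>A\<close> for \<open>e\<close>.\<close>

lemma poly_act_linear_mult:
  "A *\<^sub>v poly_act A v p = poly_act A v ([:- e, 1:] * p) + e \<cdot>\<^sub>v poly_act A v p"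
proof -
  have c: "poly_act A v p \<in> carrier_vec n" by (rule poly_act_closed)
  have "[:- e, 1:] * p = smult (- e) p + pCons 0 p" by simp
  hence "poly_act A v ([:- e, 1:] * p) = (- e) \<cdot>\<^sub>v poly_act A v p + (0 \<cdot>\<^sub>v v + A *\<^sub>v poly_act A v p)"
    by (simp only: poly_act_add poly_act_smult poly_act_pCons)
  thus ?thesis using A v c by (intro eq_vecI) auto
qed

text \<open>The eigenspace of \<open>C\<close> for \<open>e\<close> is stable under matrices
  commuting with \<open>C\<close>, hence under polynomials in \<open>A\<close>. An eigenvector of
  \<open>A\<close> built from \<open>v\<close> in this way does not lose what was already secured
  for other matrices.\<close>

lemma poly_act_commute:
  assumes C: "C \<in> carrier_mat n n" and comm: "C * A = A * C" and ev: "C *\<^sub>v v = e \<cdot>\<^sub>v v"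
  shows "C *\<^sub>v poly_act A v p = e \<cdot>\<^sub>v poly_act A v p"
proof (induction p)
  case 0
  show ?case using C by (intro eq_vecI) (auto simp: poly_act_0)
next
  case (pCons a p)
  let ?u = "poly_act A v p"
  have u: "?u \<in> carrier_vec n" by (rule poly_act_closed)
  have "C *\<^sub>v (A *\<^sub>v ?u) = (C * A) *\<^sub>v ?u" using C A u by (simp add: assoc_mult_mat_vec)
  also have "\<dots> = A *\<^sub>v (C *\<^sub>v ?u)" using C A u by (simp add: comm assoc_mult_mat_vec)
  also have "\<dots> = e \<cdot>\<^sub>v (A *\<^sub>v ?u)" using A u by (simp add: pCons mult_mat_vec)
  finally have 1: "C *\<^sub>v (A *\<^sub>v ?u) = e \<cdot>\<^sub>v (A *\<^sub>v ?u)" .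
  have "C *\<^sub>v (a \<cdot>\<^sub>v v + A *\<^sub>v ?u) = a \<cdot>\<^sub>v (C *\<^sub>v v) + C *\<^sub>v (A *\<^sub>v ?u)"
    using C A u v by (simp add: mult_add_distrib_mat_vec mult_mat_vec)
  also have "\<dots> = e \<cdot>\<^sub>v (a \<cdot>\<^sub>v v + A *\<^sub>v ?u)"
    unfolding 1 ev using A u v by (intro eq_vecI) (auto simp: algebra_simps)
  finally show ?case by (simp add: poly_act_pCons)
qed

text \<open>Linear factors are split off the annihilating polynomial until the rest no longer
  annihilates \<open>v\<close>; the factor removed last then exhibits an eigenvector. This must
  happen, since a nonzero constant does not annihilate a nonzero vector.\<close>

lemma poly_act_eigenvector:
  assumes "p \<noteq> 0" "poly_act A v p = 0\<^sub>v n" "v \<noteq> 0\<^sub>v n"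
  shows "\<exists>q e. poly_act A v q \<noteq> 0\<^sub>v n \<and> A *\<^sub>v poly_act A v q = e \<cdot>\<^sub>v poly_act A v q"
  using assms(1,2)
proof (induction "degree p" arbitrary: p)
  case 0
  then obtain a where p: "p = [:a:]" by (metis degree_eq_zeroE)
  with 0 have a: "a \<noteq> 0" by auto
  have "A *\<^sub>v 0\<^sub>v n = 0\<^sub>v n" using A by (intro eq_vecI) auto
  hence av: "a \<cdot>\<^sub>v v = 0\<^sub>v n" using 0(3) v by (simp add: p poly_act_pCons poly_act_0)
  have "v = 0\<^sub>v n"
  proof (rule eq_vecI)
    fix i assume i: "i < dim_vec (0\<^sub>v n :: complex vec)"
    have "(a \<cdot>\<^sub>v v) $ i = 0" unfolding av using i by auto
    thus "v $ i = 0\<^sub>v n $ i" using i v a by auto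
  qed (use v in auto)
  with assms(3) show ?case by simp
next
  case (Suc d)
  from Suc(2) have "\<not> constant (poly p)" by (simp add: constant_degree)
  then obtain e where "poly p e = 0" using fundamental_theorem_of_algebra by blast
  then obtain q where p: "p = [:- e, 1:] * q" by (auto simp: poly_eq_0_iff_dvd)
  have q: "q \<noteq> 0" using Suc p by auto
  have "degree p = Suc (degree q)" unfolding p using q by (subst degree_mult_eq) auto
  hence d: "d = degree q" using Suc by simp
  show ?case
  proof (cases "poly_act A v q = 0\<^sub>v n")
    case True
    show ?thesis by (rule Suc(1)[OF d q True])
  next
    case False
    have "A *\<^sub>v poly_act A v q = e \<cdot>\<^sub>v poly_act A v q"
      using poly_act_linear_mult[of q e] Suc(4) poly_act_closed[of q] by (simp add: p)
    with False show ?thesis by blast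
  qed
qed

end

lemma smult_mat_mult_mat_vec_assoc:
  assumes "A \<in> carrier_mat nr nc" "v \<in> carrier_vec nc"
  shows "(k \<cdot>\<^sub>m A) *\<^sub>v v = k \<cdot>\<^sub>v (A *\<^sub>v (v :: complex vec))"
  using assms by (intro eq_vecI) (auto simp: scalar_prod_def sum_distrib_left mult.assoc)

text \<open>A homomorphism of Q-algebras commutes with rational polynomials. Hence a rational
  relation satisfied by \<open>b\<close> annihilates every vector under
  \<open>\<rho> b\<close>.\<close>

lemma poly_act_matrix_rep:
  assumes rep: "matrix_rep L n \<rho>" and L: "is_subfield L" and b: "b \<in> L" and v: "v \<in> carrier_vec n"
  shows "poly (map_poly of_rat p) b \<in> L \<and>
    poly_act (\<rho> b) v (map_poly of_rat p) = \<rho> (poly (map_poly of_rat p) b) *\<^sub>v v"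
proof (induction p)
  case 0
  have 0: "\<rho> 0 = 0\<^sub>m n n"
  proof -
    have "\<rho> (of_rat 0 * 1) = of_rat 0 \<cdot>\<^sub>m \<rho> 1"
      using rep L unfolding matrix_rep_def is_subfield_def by metis
    moreover have "\<rho> 1 = 1\<^sub>m n" using rep by (simp add: matrix_rep_def)
    ultimately show ?thesis by (auto intro: eq_matI)
  qed
  have "\<rho> b \<in> carrier_mat n n" using rep b by (auto simp: matrix_rep_def)
  from poly_act_0[OF this v] L v show ?case by (auto simp: 0 is_subfield_def)
next
  case (pCons a p)
  let ?P = "poly (map_poly of_rat p) b"
  have Rb: "\<rho> b \<in> carrier_mat n n" and RP: "\<rho> ?P \<in> carrier_mat n n" using rep b pCons by (auto simp: matrix_rep_def)
  have inL: "1 \<in> L" "of_rat a \<in> L" "b * ?P \<in> L" using L b pCons subfield_of_rat[OF L] by (auto simp: is_subfield_def)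
  have e: "map_poly of_rat (pCons a p) = (pCons (of_rat a) (map_poly of_rat p) :: complex poly)"
    by (rule poly_eqI) (auto simp: coeff_map_poly coeff_pCons split: nat.split)
  have "\<rho> (of_rat a * 1) = of_rat a \<cdot>\<^sub>m \<rho> 1" using rep inL unfolding matrix_rep_def by blast
  hence ra: "\<rho> (of_rat a) = of_rat a \<cdot>\<^sub>m 1\<^sub>m n" using rep by (simp add: matrix_rep_def)
  have "\<rho> (of_rat a + b * ?P) = of_rat a \<cdot>\<^sub>m 1\<^sub>m n + \<rho> b * \<rho> ?P"
    using rep inL b pCons ra unfolding matrix_rep_def by auto
  hence "\<rho> (of_rat a + b * ?P) *\<^sub>v v = of_rat a \<cdot>\<^sub>v v + \<rho> b *\<^sub>v (\<rho> ?P *\<^sub>v v)"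
    using Rb RP v by (simp add: add_mult_distrib_mat_vec[of _ n n] assoc_mult_mat_vec[of _ n n _ n]
        smult_mat_mult_mat_vec_assoc[of _ n n])
  thus ?case using pCons inL L Rb v
    by (auto simp: e poly_act_pCons[OF Rb v] is_subfield_def)
qed


section \<open>Common eigenvectors of the representing matrices\<close>

lemma vector_space_rat_complex: "vector_space (\<lambda>(q::rat) (z::complex). of_rat q * z)"
  by unfold_locales (auto simp: of_rat_add of_rat_mult algebra_simps)

lemma subfield_power: "is_subfield L \<Longrightarrow> a \<in> L \<Longrightarrow> a ^ i \<in> L"
  by (induction i) (auto simp: is_subfield_def)

text \<open>The n + 1 powers of \<open>b\<close> up to exponent \<open>n\<close> lie in a space
  spanned by \<open>n\<close> elements. Linear dependence speaks of sets, so coinciding powers are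
  treated apart; there a difference of two monomials does.\<close>

lemma field_degree_algebraic:
  assumes L: "is_subfield L" and deg: "field_degree L n" and b: "b \<in> L"
  shows "\<exists>p::rat poly. p \<noteq> 0 \<and> poly (map_poly of_rat p) b = 0"
proof (cases "inj_on (\<lambda>i. b ^ i) {..n}")
  case True
  interpret rv: vector_space "\<lambda>(q::rat) (z::complex). of_rat q * z"
    by (rule vector_space_rat_complex)
  let ?S = "(\<lambda>i. b ^ i) ` {..n}"
  obtain B where B: "finite B" "card B = n" "B \<subseteq> L"
    "L = {\<Sum>b\<in>B. of_rat (q b) * b | q :: complex \<Rightarrow> rat. True}"
    using deg unfolding field_degree_def by blast
  have "?S \<subseteq> L" using L b by (auto intro: subfield_power)
  also have "L \<subseteq> rv.span B" unfolding B(4)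
    by (auto intro!: rv.span_sum intro: rv.span_scale rv.span_base)
  finally have "?S \<subseteq> rv.span B" .
  moreover have "card ?S = Suc n" using True by (simp add: card_image)
  ultimately have "rv.dependent ?S"
    using rv.independent_span_bound[OF B(1), of ?S] B(2) by auto
  then obtain u where u: "\<exists>v\<in>?S. u v \<noteq> 0" "(\<Sum>v\<in>?S. of_rat (u v) * v) = 0"
    using rv.dependent_finite[of ?S] by auto
  define p where "p = (\<Sum>i\<le>n. monom (u (b ^ i)) i)"
  have cp: "coeff p i = (if i \<le> n then u (b ^ i) else 0)" for i
    by (auto simp: p_def coeff_sum)
  have "p \<noteq> 0" using u(1) cp by (auto simp: poly_eq_iff)
  moreover have "poly (map_poly of_rat p) b = (\<Sum>i\<le>n. of_rat (u (b ^ i)) * b ^ i)"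
    by (subst poly_altdef, rule sum.mono_neutral_cong)
      (auto simp: coeff_map_poly cp coeff_eq_0 le_degree, metis (no_types, lifting) coeff_eq_0 cp not_le of_rat_0)
  moreover have "\<dots> = (\<Sum>v\<in>?S. of_rat (u v) * v)" using True by (simp add: sum.reindex)
  ultimately show ?thesis using u(2) by auto
next
  case False
  then obtain i j where ij: "i \<noteq> j" "b ^ i = b ^ j" by (auto simp: inj_on_def)
  let ?p = "monom 1 i - monom 1 j :: rat poly"
  have "coeff ?p i \<noteq> 0" using ij by simp
  hence "?p \<noteq> 0" by (metis coeff_0)
  moreover have "map_poly of_rat ?p = (monom 1 i - monom 1 j :: complex poly)"
    by (rule poly_eqI) (auto simp: coeff_map_poly of_rat_diff)
  hence "poly (map_poly of_rat ?p) b = 0" using ij by (simp add: poly_monom)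
  ultimately show ?thesis by blast
qed

text \<open>The elements of \<open>S\<close> are added one by one: the new vector is a polynomial in
  \<open>\<rho> b\<close> applied to the old one, so by commutativity it remains an eigenvector of
  the matrices treated before.\<close>

lemma common_eigenvector_finite:
  assumes rep: "matrix_rep L n \<rho>" and L: "is_subfield L" and deg: "field_degree L d" and n: "n > 0"
    and "finite S" "S \<subseteq> L"
  shows "\<exists>v\<in>carrier_vec n. v \<noteq> 0\<^sub>v n \<and> (\<forall>b\<in>S. \<exists>e. \<rho> b *\<^sub>v v = e \<cdot>\<^sub>v v)"
  using assms(5,6)
proof (induction S)
  case empty
  have "unit_vec n 0 \<noteq> (0\<^sub>v n :: complex vec)" using n
    by (metis index_unit_vec(1) index_zero_vec(1) zero_neq_one)
  thus ?case by (auto intro!: bexI[of _ "unit_vec n 0"])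
next
  case (insert b S)
  then obtain v where v: "v \<in> carrier_vec n" "v \<noteq> 0\<^sub>v n" "\<forall>c\<in>S. \<exists>e. \<rho> c *\<^sub>v v = e \<cdot>\<^sub>v v" by auto
  have b: "b \<in> L" using insert by simp
  have R: "\<rho> c \<in> carrier_mat n n" if "c \<in> L" for c using rep that by (auto simp: matrix_rep_def)
  obtain p :: "rat poly" where p: "p \<noteq> 0" "poly (map_poly of_rat p) b = 0"
    using field_degree_algebraic[OF L deg b] by blast
  \<comment> \<open>That \<open>\<rho> 0\<close> kills \<open>v\<close> is not part of
    \<open>matrix_rep\<close>; it comes from comparison with the zero polynomial.\<close>
  have "poly_act (\<rho> b) v (map_poly of_rat p) = \<rho> 0 *\<^sub>v v"
    using poly_act_matrix_rep[OF rep L b v(1), of p] p by simp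
  also have "\<dots> = poly_act (\<rho> b) v (map_poly of_rat 0)"
    using poly_act_matrix_rep[OF rep L b v(1), of 0] by simp
  also have "\<dots> = 0\<^sub>v n" by (simp add: poly_act_0[OF R[OF b] v(1)])
  finally have "poly_act (\<rho> b) v (map_poly of_rat p) = 0\<^sub>v n" .
  moreover have "map_poly of_rat p \<noteq> (0 :: complex poly)"
    using p(1) by (simp add: poly_eq_iff coeff_map_poly)
  ultimately obtain q e where q: "poly_act (\<rho> b) v q \<noteq> 0\<^sub>v n"
    "\<rho> b *\<^sub>v poly_act (\<rho> b) v q = e \<cdot>\<^sub>v poly_act (\<rho> b) v q"
    using poly_act_eigenvector[OF R[OF b] v(1) _ _ v(2)] by blast
  have "\<exists>e. \<rho> c *\<^sub>v poly_act (\<rho> b) v q = e \<cdot>\<^sub>v poly_act (\<rho> b) v q" if c: "c \<in> S" for c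
  proof -
    obtain e where "\<rho> c *\<^sub>v v = e \<cdot>\<^sub>v v" using v(3) c by blast
    moreover have "c \<in> L" using c insert by auto
    moreover have "\<rho> c * \<rho> b = \<rho> b * \<rho> c"
      using rep b \<open>c \<in> L\<close> unfolding matrix_rep_def by (metis mult.commute)
    ultimately show ?thesis using poly_act_commute[OF R[OF b] v(1) R[OF \<open>c \<in> L\<close>]] by blast
  qed
  thus ?case using q poly_act_closed[OF R[OF b] v(1)] by blast
qed

text \<open>A common eigenvector for a finite set spanning \<open>L\<close> over the rationals
  serves all of \<open>L\<close>, since sums and rational multiples keep it an eigenvector.\<close>

lemma common_eigenvector:
  assumes rep: "matrix_rep L n \<rho>" and L: "is_subfield L" and deg: "field_degree L d" and n: "n > 0"
  obtains v h where "v \<in> carrier_vec n" "v \<noteq> 0\<^sub>v n" "\<And>a. a \<in> L \<Longrightarrow> \<rho> a *\<^sub>v v = h a \<cdot>\<^sub>v v"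
proof -
  obtain B where B: "finite B" "B \<subseteq> L"
    "L = {\<Sum>b\<in>B. of_rat (q b) * b | q :: complex \<Rightarrow> rat. True}"
    using deg unfolding field_degree_def by blast
  obtain v where v: "v \<in> carrier_vec n" "v \<noteq> 0\<^sub>v n" "\<forall>b\<in>B. \<exists>e. \<rho> b *\<^sub>v v = e \<cdot>\<^sub>v v"
    using common_eigenvector_finite[OF rep L deg n B(1,2)] by blast
  have R: "\<rho> c \<in> carrier_mat n n" if "c \<in> L" for c using rep that by (auto simp: matrix_rep_def)
  have scale: "\<exists>e. \<rho> (of_rat q * a) *\<^sub>v v = e \<cdot>\<^sub>v v" if "a \<in> L" "\<rho> a *\<^sub>v v = e \<cdot>\<^sub>v v" for a e q
  proof
    have "\<rho> (of_rat q * a) = of_rat q \<cdot>\<^sub>m \<rho> a" using rep that(1) by (auto simp: matrix_rep_def)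
    thus "\<rho> (of_rat q * a) *\<^sub>v v = (of_rat q * e) \<cdot>\<^sub>v v"
      using R[OF that(1)] v(1) that(2) by (simp add: smult_mat_mult_mat_vec_assoc smult_smult_assoc)
  qed
  have sum: "(\<Sum>b\<in>S. of_rat (q b) * b) \<in> L \<and> (\<exists>e. \<rho> (\<Sum>b\<in>S. of_rat (q b) * b) *\<^sub>v v = e \<cdot>\<^sub>v v)"
    if "finite S" "S \<subseteq> B" for S q
    using that
  proof (induction S)
    case empty
    have 0: "0 \<in> L" "1 \<in> L" using L by (auto simp: is_subfield_def)
    have "\<rho> 1 *\<^sub>v v = 1 \<cdot>\<^sub>v v" using rep v(1) by (simp add: matrix_rep_def)
    from scale[OF 0(2) this, of 0] 0 show ?case by simp
  next
    case (insert b S)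
    let ?s = "\<Sum>b\<in>S. of_rat (q b) * b"
    have b: "b \<in> L" using insert B(2) by auto
    hence qb: "of_rat (q b) * b \<in> L" using L subfield_of_rat[OF L] by (auto simp: is_subfield_def)
    obtain e where e: "\<rho> ?s *\<^sub>v v = e \<cdot>\<^sub>v v" "?s \<in> L" using insert by auto
    obtain e' where e': "\<rho> (of_rat (q b) * b) *\<^sub>v v = e' \<cdot>\<^sub>v v"
      using scale[OF b] v(3) insert(4) by blast
    have "\<rho> (of_rat (q b) * b + ?s) = \<rho> (of_rat (q b) * b) + \<rho> ?s"
      using rep qb e(2) unfolding matrix_rep_def by blast
    hence "\<rho> (of_rat (q b) * b + ?s) *\<^sub>v v = (e' + e) \<cdot>\<^sub>v v"
      using e e' v(1) R[OF qb] R[OF e(2)] by (simp add: add_mult_distrib_mat_vec add_smult_distrib_vec)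
    moreover have "of_rat (q b) * b + ?s \<in> L" using qb e(2) L by (auto simp: is_subfield_def)
    ultimately show ?case using insert(1,2) by auto
  qed
  have "\<exists>e. \<rho> a *\<^sub>v v = e \<cdot>\<^sub>v v" if a: "a \<in> L" for a
  proof -
    obtain q where "a = (\<Sum>b\<in>B. of_rat (q b) * b)" using a unfolding B(3) by blast
    thus ?thesis using sum[OF B(1) order.refl] by simp
  qed
  hence "\<rho> a *\<^sub>v v = (SOME e. \<rho> a *\<^sub>v v = e \<cdot>\<^sub>v v) \<cdot>\<^sub>v v" if "a \<in> L" for a
    using that by (metis (mono_tags, lifting) someI_ex)
  thus ?thesis by (rule that[OF v(1,2)])
qed

text \<open>Any nonzero coordinate of the eigenvector recovers the eigenvalue, so the identities of
  \<open>\<rho>\<close> descend to \<open>h\<close>.\<close>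

lemma eigenvector_embedding:
  assumes rep: "matrix_rep L n \<rho>" and L: "is_subfield L"
    and v: "v \<in> carrier_vec n" "v \<noteq> 0\<^sub>v n" "\<And>a. a \<in> L \<Longrightarrow> \<rho> a *\<^sub>v v = h a \<cdot>\<^sub>v v"
  shows "rational_embedding L h"
proof -
  obtain i where i: "i < n" "v $ i \<noteq> 0"
    using v(1,2) by (metis carrier_vecD eq_vecI index_zero_vec)
  have eqI: "x = y" if "x \<cdot>\<^sub>v v = y \<cdot>\<^sub>v v" for x y
    using arg_cong[OF that, of "\<lambda>u. u $ i"] i v(1) by simp
  have R: "\<rho> c \<in> carrier_mat n n" if "c \<in> L" for c using rep that by (auto simp: matrix_rep_def)
  have clo: "1 \<in> L" "\<And>a b. a \<in> L \<Longrightarrow> b \<in> L \<Longrightarrow> a + b \<in> L \<and> a * b \<in> L" "\<And>a q. a \<in> L \<Longrightarrow> of_rat q * a \<in> L"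
    using L subfield_of_rat[OF L] by (auto simp: is_subfield_def)
  have "h 1 = 1"
    by (rule eqI) (use v(3)[OF clo(1)] rep v(1) in \<open>simp add: matrix_rep_def\<close>)
  moreover have "h (a + b) = h a + h b" if "a \<in> L" "b \<in> L" for a b
  proof (rule eqI)
    have "\<rho> (a + b) = \<rho> a + \<rho> b" using rep that unfolding matrix_rep_def by blast
    thus "h (a + b) \<cdot>\<^sub>v v = (h a + h b) \<cdot>\<^sub>v v"
      using v(3)[of "a + b"] v(3)[OF that(1)] v(3)[OF that(2)] clo(2)[OF that] R that v(1)
      by (simp add: add_mult_distrib_mat_vec[of _ n n] add_smult_distrib_vec)
  qed
  moreover have "h (a * b) = h a * h b" if "a \<in> L" "b \<in> L" for a b
  proof (rule eqI)
    have "\<rho> (a * b) = \<rho> a * \<rho> b" using rep that unfolding matrix_rep_def by blast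
    hence "\<rho> (a * b) *\<^sub>v v = \<rho> a *\<^sub>v (\<rho> b *\<^sub>v v)"
      using R that v(1) by (simp add: assoc_mult_mat_vec[of _ n n _ n])
    also have "\<dots> = h b \<cdot>\<^sub>v (\<rho> a *\<^sub>v v)"
      using v(3)[OF that(2)] mult_mat_vec[OF R[OF that(1)] v(1)] by simp
    finally show "h (a * b) \<cdot>\<^sub>v v = (h a * h b) \<cdot>\<^sub>v v"
      using v(3)[of "a * b"] v(3)[OF that(1)] clo(2)[OF that] by (simp add: smult_smult_assoc mult.commute)
  qed
  moreover have "h (of_rat q * a) = of_rat q * h a" if "a \<in> L" for a q
  proof (rule eqI)
    have "\<rho> (of_rat q * a) = of_rat q \<cdot>\<^sub>m \<rho> a" using rep that unfolding matrix_rep_def by blast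
    thus "h (of_rat q * a) \<cdot>\<^sub>v v = (of_rat q * h a) \<cdot>\<^sub>v v"
      using v(3)[OF that] v(3)[OF clo(3)[OF that, of q]] R[OF that] v(1)
      by (simp add: smult_mat_mult_mat_vec_assoc[of _ n n] smult_smult_assoc)
  qed
  ultimately show ?thesis by (auto simp: rational_embedding_def)
qed


text \<open>In a basis starting with the common eigenvector \<open>v\<close> all
  \<open>\<rho> a\<close> are block triangular at once, and the lower right block is the
  representation on the quotient by the line of \<open>v\<close>. Gram-Schmidt only serves to
  produce one invertible matrix with first column \<open>v\<close>, independent of
  \<open>a\<close>.\<close>

lemma matrix_rep_deflate:
  assumes rep: "matrix_rep L (Suc n) \<rho>" and L: "is_subfield L"
    and v: "v \<in> carrier_vec (Suc n)" "v \<noteq> 0\<^sub>v (Suc n)" "\<And>a. a \<in> L \<Longrightarrow> \<rho> a *\<^sub>v v = h a \<cdot>\<^sub>v v"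
  shows "\<exists>\<rho>'. matrix_rep L n \<rho>' \<and> (\<forall>a\<in>L. char_poly (\<rho> a) = [:- h a, 1:] * char_poly (\<rho>' a))"
proof -
  let ?N = "Suc n"
  interpret cof_vec_space ?N "TYPE(complex)" .
  define b where "b = basis_completion v"
  define ws where "ws = gram_schmidt ?N b"
  define W where "W = mat_of_cols ?N ws"
  define W' where "W' = corthogonal_inv W"
  from basis_completion[OF v(1,2), folded b_def]
  have dist_b: "distinct b" and indep: "\<not> lin_dep (set b)" and b: "set b \<subseteq> carrier_vec ?N"
    and hdb: "hd b = v" and len_b: "length b = ?N" by auto
  from hdb len_b obtain vs where bv: "b = v # vs" by (cases b) auto
  from gram_schmidt_result[OF b dist_b indep ws_def]
  have ws: "set ws \<subseteq> carrier_vec ?N" "corthogonal ws" "length ws = ?N"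
    by (auto simp: len_b)
  from gram_schmidt_hd[OF v(1), of vs, folded bv] have hdws: "hd ws = v" unfolding ws_def .
  have orth_W: "corthogonal_mat W" using orthogonal_mat_of_cols ws unfolding W_def .
  have W: "W \<in> carrier_mat ?N ?N"
    using ws unfolding W_def using mat_of_cols_carrier(1)[of ?N ws] by auto
  have W': "W' \<in> carrier_mat ?N ?N" unfolding W'_def corthogonal_inv_def using W
    by (auto simp: mat_of_rows_def)
  from corthogonal_inv_result[OF orth_W] have "inverts_mat W' W" unfolding W'_def .
  hence W'W: "W' * W = 1\<^sub>m ?N" using W' by (simp add: inverts_mat_def)
  hence WW': "W * W' = 1\<^sub>m ?N" using mat_mult_left_right_inverse[OF W' W] by auto
  have R: "\<rho> c \<in> carrier_mat ?N ?N" if "c \<in> L" for c using rep that by (auto simp: matrix_rep_def)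
  define A where "A a = W' * \<rho> a * W" for a
  have A: "A a \<in> carrier_mat ?N ?N" if "a \<in> L" for a using R[OF that] W W' by (auto simp: A_def)
  have col0: "col (A a) 0 = vec ?N (\<lambda>i. if i = 0 then h a else 0)" if "a \<in> L" for a
    unfolding A_def W'_def W_def
    by (rule corthogonal_col_ev_0[OF R[OF that] v(1,2) v(3)[OF that] _ hdws ws]) simp
  have A00: "A a $$ (0, 0) = h a" if "a \<in> L" for a
    using arg_cong[OF col0[OF that], of "\<lambda>u. u $ 0"] A[OF that] by simp
  have A0: "A a $$ (Suc i, 0) = 0" if "a \<in> L" "i < n" for a i
    using arg_cong[OF col0[OF that(1)], of "\<lambda>u. u $ Suc i"] A[OF that(1)] that(2) by simp
  have clo: "1 \<in> L" "\<And>a b. a \<in> L \<Longrightarrow> b \<in> L \<Longrightarrow> a + b \<in> L \<and> a * b \<in> L" "\<And>a q. a \<in> L \<Longrightarrow> of_rat q * a \<in> L"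
    using L subfield_of_rat[OF L] by (auto simp: is_subfield_def)
  have A_one: "A 1 = 1\<^sub>m ?N" using rep W W' W'W by (simp add: A_def matrix_rep_def)
  have A_add: "A (a + b) = A a + A b" if "a \<in> L" "b \<in> L" for a b
  proof -
    have "\<rho> (a + b) = \<rho> a + \<rho> b" using rep that unfolding matrix_rep_def by blast
    thus ?thesis using R that W W'
      by (simp add: A_def mult_add_distrib_mat[of _ ?N ?N _ ?N] add_mult_distrib_mat[of _ ?N ?N _ _ ?N])
  qed
  have A_mult: "A (a * b) = A a * A b" if "a \<in> L" "b \<in> L" for a b
  proof -
    have "A a * A b = W' * \<rho> a * (W * (W' * (\<rho> b * W)))"
      using R[OF that(1)] R[OF that(2)] W W'
      by (simp add: A_def assoc_mult_mat[of _ ?N ?N _ ?N _ ?N])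
    also have "W * (W' * (\<rho> b * W)) = \<rho> b * W"
      using assoc_mult_mat[OF W W', of "\<rho> b * W" ?N] R[OF that(2)] W WW' by simp
    also have "W' * \<rho> a * (\<rho> b * W) = W' * (\<rho> a * \<rho> b) * W"
      using R[OF that(1)] R[OF that(2)] W W' by (simp add: assoc_mult_mat[of _ ?N ?N _ ?N _ ?N])
    also have "\<rho> a * \<rho> b = \<rho> (a * b)" using rep that unfolding matrix_rep_def by metis
    finally show ?thesis by (simp add: A_def)
  qed
  have A_scale: "A (of_rat q * a) = of_rat q \<cdot>\<^sub>m A a" if "a \<in> L" for a q
  proof -
    have "\<rho> (of_rat q * a) = of_rat q \<cdot>\<^sub>m \<rho> a" using rep that unfolding matrix_rep_def by blast
    thus ?thesis using R[OF that] W W'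
      by (simp add: A_def mult_smult_distrib[of _ ?N ?N _ ?N] mult_smult_assoc_mat[of _ ?N ?N _ ?N])
  qed
  define \<rho>' where "\<rho>' a = mat n n (\<lambda>(i, j). A a $$ (Suc i, Suc j))" for a
  have "\<rho>' 1 = 1\<^sub>m n" by (rule eq_matI) (auto simp: \<rho>'_def A_one)
  moreover have "\<rho>' (a + b) = \<rho>' a + \<rho>' b" if "a \<in> L" "b \<in> L" for a b
    using A[OF that(1)] A[OF that(2)] by (intro eq_matI) (auto simp: \<rho>'_def A_add[OF that])
  moreover have "\<rho>' (a * b) = \<rho>' a * \<rho>' b" if "a \<in> L" "b \<in> L" for a b
  proof (rule eq_matI)
    fix i j assume "i < dim_row (\<rho>' a * \<rho>' b)" "j < dim_col (\<rho>' a * \<rho>' b)"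
    hence ij: "i < n" "j < n" by (auto simp: \<rho>'_def)
    have "\<rho>' (a * b) $$ (i, j) = (A a * A b) $$ (Suc i, Suc j)"
      using ij by (simp add: \<rho>'_def A_mult[OF that])
    also have "\<dots> = (\<Sum>k=0..<Suc n. A a $$ (Suc i, k) * A b $$ (k, Suc j))"
      using A[OF that(1)] A[OF that(2)] ij by (simp add: scalar_prod_def)
    \<comment> \<open>The term for k = 0 vanishes because the first column of \<open>A a\<close> is
      zero below the corner; this makes the lower right block multiplicative.\<close>
    also have "\<dots> = (\<Sum>k=0..<n. A a $$ (Suc i, Suc k) * A b $$ (Suc k, Suc j))"
      using A0[OF that(1) ij(1)] by (simp add: sum.atLeast0_lessThan_Suc_shift del: sum.op_ivl_Suc)
    also have "\<dots> = (\<rho>' a * \<rho>' b) $$ (i, j)"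
      using ij by (simp add: \<rho>'_def scalar_prod_def)
    finally show "\<rho>' (a * b) $$ (i, j) = (\<rho>' a * \<rho>' b) $$ (i, j)" .
  qed (auto simp: \<rho>'_def)
  moreover have "\<rho>' (of_rat q * a) = of_rat q \<cdot>\<^sub>m \<rho>' a" if "a \<in> L" for a q
    using A[OF that] by (intro eq_matI) (auto simp: \<rho>'_def A_scale[OF that])
  ultimately have "matrix_rep L n \<rho>'" by (auto simp: matrix_rep_def) (auto simp: \<rho>'_def)
  moreover have "char_poly (\<rho> a) = [:- h a, 1:] * char_poly (\<rho>' a)" if a: "a \<in> L" for a
  proof -
    have "similar_mat_wit (A a) (\<rho> a) W' W"
      by (rule similar_mat_witI[of _ _ ?N]) (use W W' R[OF a] A[OF a] W'W WW' in \<open>auto simp: A_def\<close>)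
    hence "char_poly (\<rho> a) = char_poly (A a)"
      using char_poly_similar[of "A a" "\<rho> a"] unfolding similar_mat_def by metis
    also have "A a = four_block_mat (mat 1 1 (\<lambda>_. h a)) (mat 1 n (\<lambda>(i, j). A a $$ (0, Suc j))) (0\<^sub>m n 1) (\<rho>' a)"
      (is "_ = four_block_mat ?A1 ?A2 _ _")
    proof (rule eq_matI)
      fix i j assume "i < dim_row (four_block_mat ?A1 ?A2 (0\<^sub>m n 1) (\<rho>' a))"
        "j < dim_col (four_block_mat ?A1 ?A2 (0\<^sub>m n 1) (\<rho>' a))"
      hence ij: "i < Suc n" "j < Suc n" by (auto simp: \<rho>'_def)
      thus "A a $$ (i, j) = four_block_mat ?A1 ?A2 (0\<^sub>m n 1) (\<rho>' a) $$ (i, j)"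
        using A00[OF a] A0[OF a] by (cases i; cases j) (auto simp: \<rho>'_def)
    qed (use A[OF a] in \<open>auto simp: \<rho>'_def\<close>)
    also have "char_poly \<dots> = char_poly ?A1 * char_poly (\<rho>' a)"
      by (rule char_poly_four_block_zeros_col) (auto simp: \<rho>'_def)
    also have "char_poly ?A1 = [:- h a, 1:]"
      by (simp add: char_poly_defs det_def sign_def)
    finally show ?thesis .
  qed
  ultimately show ?thesis by blast
qed

text \<open>Repeated deflation. What matters is the order of the quantifiers: one list
  \<open>h\<close> works for all \<open>a\<close> in \<open>L\<close>, whereas factoring each
  characteristic polynomial by itself would not match the eigenvalues of different elements.\<close>

lemma matrix_rep_char_poly:
  assumes L: "is_subfield L" and deg: "field_degree L d"
  shows "matrix_rep L n \<rho> \<Longrightarrow> \<exists>h. (\<forall>i<n. rational_embedding L (h i)) \<and>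
     (\<forall>a\<in>L. char_poly (\<rho> a) = (\<Prod>i<n. [:- h i a, 1:]))"
proof (induction n arbitrary: \<rho>)
  case 0
  have "char_poly (\<rho> a) = 1" if "a \<in> L" for a
  proof -
    have "degree (char_poly (\<rho> a)) = 0 \<and> coeff (char_poly (\<rho> a)) 0 = 1"
      using 0 that degree_monic_char_poly[of "\<rho> a" 0] by (auto simp: matrix_rep_def)
    thus ?thesis by (metis coeff_pCons_0 degree_eq_zeroE one_pCons)
  qed
  thus ?case by auto
next
  case (Suc n)
  obtain v h where v: "v \<in> carrier_vec (Suc n)" "v \<noteq> 0\<^sub>v (Suc n)" "\<And>a. a \<in> L \<Longrightarrow> \<rho> a *\<^sub>v v = h a \<cdot>\<^sub>v v"
    using common_eigenvector[OF Suc.prems L deg] by auto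
  obtain \<rho>' where \<rho>': "matrix_rep L n \<rho>'"
    "\<forall>a\<in>L. char_poly (\<rho> a) = [:- h a, 1:] * char_poly (\<rho>' a)"
    using matrix_rep_deflate[OF Suc.prems L v] by blast
  obtain g where g: "\<forall>i<n. rational_embedding L (g i)" "\<forall>a\<in>L. char_poly (\<rho>' a) = (\<Prod>i<n. [:- g i a, 1:])"
    using Suc.IH[OF \<rho>'(1)] by blast
  have h: "rational_embedding L h" by (rule eigenvector_embedding[OF Suc.prems L v])
  define f where "f = g(n := h)"
  have "\<forall>i<Suc n. rational_embedding L (f i)" using g h by (auto simp: f_def less_Suc_eq)
  moreover have "\<forall>a\<in>L. char_poly (\<rho> a) = (\<Prod>i<Suc n. [:- f i a, 1:])"
    using g \<rho>' by (auto simp: f_def mult.commute simp del: mult_pCons_left mult_pCons_right)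
  ultimately show ?case by blast
qed

text \<open>The embeddings are the joint eigenvalues of the regular representation of \<open>L\<close>.\<close>

lemma field_embeddings:
  assumes L: "is_subfield L" and deg: "field_degree L n"
  shows "\<exists>h. (\<forall>i<n. rational_embedding L (h i)) \<and>
     (\<forall>a\<in>L. \<exists>q. (\<Prod>i<n. [:- h i a, 1:]) = map_poly of_rat q)"
proof -
  obtain B where B: "finite B" "card B = n" "B \<subseteq> L"
    "\<forall>q :: complex \<Rightarrow> rat. (\<Sum>b\<in>B. of_rat (q b) * b) = 0 \<longrightarrow> (\<forall>b\<in>B. q b = 0)"
    "L = {\<Sum>b\<in>B. of_rat (q b) * b | q :: complex \<Rightarrow> rat. True}"
    using deg unfolding field_degree_def by blast
  obtain e where e: "bij_betw e {0..<n} B" using B(1,2) ex_bij_betw_nat_finite by blast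
  have sum_e: "(\<Sum>b\<in>B. of_rat (q b) * b) = (\<Sum>i=0..<n. of_rat (q (e i)) * e i)" for q :: "complex \<Rightarrow> rat"
    by (rule sum.reindex_bij_betw[OF e, symmetric])
  have eL: "e i \<in> L" if "i < n" for i using e B(3) that by (auto simp: bij_betw_def)
  have uniq: "q i = r i"
    \<comment> \<open>Independence of the set \<open>B\<close> becomes uniqueness of coordinates
      indexed by \<open>i < n\<close>; coefficients are carried back to \<open>B\<close> through the
      inverse of \<open>e\<close>.\<close>
    if "(\<Sum>i=0..<n. of_rat (q i) * e i) = (\<Sum>i=0..<n. of_rat (r i) * e i)" "i < n" for q r :: "nat \<Rightarrow> rat" and i
  proof -
    define s where "s b = q (the_inv_into {0..<n} e b) - r (the_inv_into {0..<n} e b)" for b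
    have s: "s (e i) = q i - r i" if "i < n" for i
      using that e by (simp add: s_def the_inv_into_f_f bij_betw_def)
    have "(\<Sum>b\<in>B. of_rat (s b) * b) = (\<Sum>i=0..<n. of_rat (q i - r i) * e i)"
      unfolding sum_e by (rule sum.cong) (auto simp: s)
    also have "\<dots> = 0" using that(1) by (simp add: of_rat_diff algebra_simps sum_subtractf)
    finally have "s (e i) = 0" using B(4) e that(2) by (auto simp: bij_betw_def)
    thus ?thesis using s[OF that(2)] by simp
  qed
  have "\<exists>q. a = (\<Sum>i=0..<n. of_rat (q i) * e i)" if a: "a \<in> L" for a
  proof -
    obtain q where "a = (\<Sum>b\<in>B. of_rat (q b) * b)" using a unfolding B(5) by blast
    thus ?thesis using sum_e by auto
  qed
  then obtain c where c: "\<And>a. a \<in> L \<Longrightarrow> a = (\<Sum>i=0..<n. of_rat (c a i) * e i)" by metis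
  have c_eq: "c a i = q i" if "a = (\<Sum>i=0..<n. of_rat (q i) * e i)" "a \<in> L" "i < n" for a q i
    using uniq[of "c a" q i] c[OF that(2)] that by simp
  have clo: "0 \<in> L" "1 \<in> L" "\<And>a b. a \<in> L \<Longrightarrow> b \<in> L \<Longrightarrow> a + b \<in> L \<and> a * b \<in> L" "\<And>a q. a \<in> L \<Longrightarrow> of_rat q * a \<in> L"
    using L subfield_of_rat[OF L] by (auto simp: is_subfield_def)
  \<comment> \<open>The matrix of multiplication by \<open>a\<close> in the basis \<open>e\<close>.
    Its entries are rational, which is the source of the rational characteristic polynomial.\<close>
  define M where "M a = mat n n (\<lambda>(i, j). c (a * e j) i)" for a
  define \<rho> where "\<rho> a = map_mat (of_rat :: rat \<Rightarrow> complex) (M a)" for a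
  have "\<rho> 1 = 1\<^sub>m n"
  proof (rule eq_matI)
    fix i j assume "i < dim_row (1\<^sub>m n :: complex mat)" "j < dim_col (1\<^sub>m n :: complex mat)"
    hence ij: "i < n" "j < n" by auto
    have "e j = (\<Sum>i=0..<n. of_rat (if i = j then 1 else 0) * e i)"
      using ij by (simp add: if_distrib[of of_rat] if_distrib[of "\<lambda>x. x * _"] cong: if_cong)
    from c_eq[OF this eL[OF ij(2)] ij(1)] show "\<rho> 1 $$ (i, j) = 1\<^sub>m n $$ (i, j)"
      using ij by (simp add: \<rho>_def M_def)
  qed (auto simp: \<rho>_def M_def)
  moreover have "\<rho> (a + b) = \<rho> a + \<rho> b" if "a \<in> L" "b \<in> L" for a b
  proof (rule eq_matI)
    fix i j assume "i < dim_row (\<rho> a + \<rho> b)" "j < dim_col (\<rho> a + \<rho> b)"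
    hence ij: "i < n" "j < n" by (auto simp: \<rho>_def M_def)
    have "a * e j + b * e j = (\<Sum>i=0..<n. of_rat (c (a * e j) i) * e i) + (\<Sum>i=0..<n. of_rat (c (b * e j) i) * e i)"
      using c[of "a * e j"] c[of "b * e j"] clo(3) that eL[OF ij(2)] by simp
    hence "(a + b) * e j = (\<Sum>i=0..<n. of_rat (c (a * e j) i + c (b * e j) i) * e i)"
      by (simp add: of_rat_add algebra_simps sum.distrib)
    from c_eq[OF this _ ij(1)] show "\<rho> (a + b) $$ (i, j) = (\<rho> a + \<rho> b) $$ (i, j)"
      using ij that clo(3) eL by (simp add: \<rho>_def M_def of_rat_add)
  qed (auto simp: \<rho>_def M_def)
  moreover have "\<rho> (of_rat q * a) = of_rat q \<cdot>\<^sub>m \<rho> a" if "a \<in> L" for a q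
  proof (rule eq_matI)
    fix i j assume "i < dim_row (of_rat q \<cdot>\<^sub>m \<rho> a)" "j < dim_col (of_rat q \<cdot>\<^sub>m \<rho> a)"
    hence ij: "i < n" "j < n" by (auto simp: \<rho>_def M_def)
    have "of_rat q * (a * e j) = of_rat q * (\<Sum>i=0..<n. of_rat (c (a * e j) i) * e i)"
      using c[of "a * e j"] clo(3) that eL[OF ij(2)] by simp
    hence "of_rat q * a * e j = (\<Sum>i=0..<n. of_rat (q * c (a * e j) i) * e i)"
      by (simp add: of_rat_mult mult.assoc sum_distrib_left)
    from c_eq[OF this _ ij(1)] show "\<rho> (of_rat q * a) $$ (i, j) = (of_rat q \<cdot>\<^sub>m \<rho> a) $$ (i, j)"
      using ij that clo(3,4) eL by (simp add: \<rho>_def M_def of_rat_mult)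
  qed (auto simp: \<rho>_def M_def)
  moreover have "\<rho> (a * b) = \<rho> a * \<rho> b" if "a \<in> L" "b \<in> L" for a b
  proof (rule eq_matI)
    fix i j assume "i < dim_row (\<rho> a * \<rho> b)" "j < dim_col (\<rho> a * \<rho> b)"
    hence ij: "i < n" "j < n" by (auto simp: \<rho>_def M_def)
    have "a * (b * e j) = a * (\<Sum>k=0..<n. of_rat (c (b * e j) k) * e k)"
      using c[of "b * e j"] clo(3) that eL[OF ij(2)] by simp
    also have "\<dots> = (\<Sum>k=0..<n. of_rat (c (b * e j) k) * (a * e k))"
      by (simp add: sum_distrib_left mult_ac)
    also have "\<dots> = (\<Sum>k=0..<n. of_rat (c (b * e j) k) * (\<Sum>i=0..<n. of_rat (c (a * e k) i) * e i))"
      by (intro sum.cong refl arg_cong2[of _ _ _ _ "(*)"] c) (use clo(3) that eL in auto)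
    also have "\<dots> = (\<Sum>i=0..<n. of_rat (\<Sum>k=0..<n. c (a * e k) i * c (b * e j) k) * e i)"
      unfolding sum_distrib_left
      by (subst sum.swap) (simp add: of_rat_sum of_rat_mult sum_distrib_left sum_distrib_right mult_ac)
    finally have "a * b * e j = \<dots>" by (simp add: mult.assoc)
    from c_eq[OF this _ ij(1)] show "\<rho> (a * b) $$ (i, j) = (\<rho> a * \<rho> b) $$ (i, j)"
      using ij that clo(3) eL by (simp add: \<rho>_def M_def scalar_prod_def of_rat_sum of_rat_mult)
  qed (auto simp: \<rho>_def M_def)
  ultimately have "matrix_rep L n \<rho>" by (auto simp: matrix_rep_def) (auto simp: \<rho>_def M_def)
  then obtain h where h: "\<forall>i<n. rational_embedding L (h i)"
    "\<forall>a\<in>L. char_poly (\<rho> a) = (\<Prod>i<n. [:- h i a, 1:])"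
    using matrix_rep_char_poly[OF L deg] by blast
  have "char_poly (\<rho> a) = map_poly of_rat (char_poly (M a))" for a
    unfolding \<rho>_def by (rule of_rat_hom.char_poly_hom[of _ n]) (simp add: M_def)
  thus ?thesis using h by metis
qed

section \<open>A valuation ring of the complex numbers above 3\<close>

definition is_subring :: "complex set \<Rightarrow> bool" where
  "is_subring R \<longleftrightarrow> 1 \<in> R \<and> (\<forall>a\<in>R. \<forall>b\<in>R. a - b \<in> R \<and> a * b \<in> R)"

text \<open>As in Chevalley's extension theorem, a subring maximal among those without 1/3 turns out
  to be a valuation ring in which 3 is not a unit. It takes the place of an extension of the 3-adic
  valuation.\<close>

definition val_ring :: "complex set" where
  "val_ring = (SOME R. is_subring R \<and> inverse 3 \<notin> R \<and>
     (\<forall>R'. is_subring R' \<and> inverse 3 \<notin> R' \<and> R \<subseteq> R' \<longrightarrow> R' = R))"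

lemma inverse_3_notin_Ints: "inverse 3 \<notin> (\<int> :: complex set)"
proof
  assume "inverse 3 \<in> (\<int> :: complex set)"
  then obtain k :: int where "inverse 3 = (of_int k :: complex)" by (auto elim: Ints_cases)
  hence "of_int (3 * k) = (1 :: complex)" by (simp add: field_simps)
  hence "3 * k = 1" using of_int_eq_1_iff by blast
  thus False by presburger
qed

text \<open>Zorn's lemma, started at the integers, justifies the choice; maximality is recorded as
  the presence of 1/3 in every proper overring.\<close>

lemma val_ring_props:
  "is_subring val_ring" "inverse 3 \<notin> val_ring"
  "\<And>R. is_subring R \<Longrightarrow> val_ring \<subseteq> R \<Longrightarrow> R \<noteq> val_ring \<Longrightarrow> inverse 3 \<in> R"
proof -
  let ?S = "{R. is_subring R \<and> inverse 3 \<notin> R}"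
  have "\<int> \<in> ?S" using inverse_3_notin_Ints by (auto simp: is_subring_def)
  moreover have "\<Union>C \<in> ?S" if C: "C \<noteq> {}" "subset.chain ?S C" for C
  proof -
    have chain: "R \<subseteq> R' \<or> R' \<subseteq> R" if "R \<in> C" "R' \<in> C" for R R'
      using C(2) that by (auto simp: subset_chain_def)
    have S: "C \<subseteq> ?S" using C(2) by (auto simp: subset_chain_def)
    have "a - b \<in> \<Union>C \<and> a * b \<in> \<Union>C" if "a \<in> R" "R \<in> C" "b \<in> R'" "R' \<in> C" for a b R R'
    proof (cases "R \<subseteq> R'")
      case True
      hence "a - b \<in> R' \<and> a * b \<in> R'" using that S by (auto simp: is_subring_def)
      thus ?thesis using that by blast
    next
      case False
      hence "R' \<subseteq> R" using chain that by blast
      hence "a - b \<in> R \<and> a * b \<in> R" using that S by (auto simp: is_subring_def)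
      thus ?thesis using that by blast
    qed
    moreover have "1 \<in> \<Union>C" using C(1) S by (auto simp: is_subring_def)
    ultimately show ?thesis using S by (auto simp: is_subring_def)
  qed
  ultimately have "\<exists>M\<in>?S. \<forall>X\<in>?S. M \<subseteq> X \<longrightarrow> X = M"
    by (intro subset_Zorn_nonempty) auto
  hence "\<exists>R. is_subring R \<and> inverse 3 \<notin> R \<and>
     (\<forall>R'. is_subring R' \<and> inverse 3 \<notin> R' \<and> R \<subseteq> R' \<longrightarrow> R' = R)" by auto
  from someI_ex[OF this, folded val_ring_def]
  show "is_subring val_ring" "inverse 3 \<notin> val_ring"
    "\<And>R. is_subring R \<Longrightarrow> val_ring \<subseteq> R \<Longrightarrow> R \<noteq> val_ring \<Longrightarrow> inverse 3 \<in> R" by blast+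
qed

lemma val_ring_1 [simp]: "1 \<in> val_ring"
  and val_ring_diff [simp]: "a \<in> val_ring \<Longrightarrow> b \<in> val_ring \<Longrightarrow> a - b \<in> val_ring"
  and val_ring_mult [simp]: "a \<in> val_ring \<Longrightarrow> b \<in> val_ring \<Longrightarrow> a * b \<in> val_ring"
  using val_ring_props(1) by (auto simp: is_subring_def)

lemma val_ring_0 [simp]: "0 \<in> val_ring"
  using val_ring_diff[of 1 1] by simp

lemma val_ring_uminus [simp]: "a \<in> val_ring \<Longrightarrow> - a \<in> val_ring"
  using val_ring_diff[of 0 a] by simp

lemma val_ring_add [simp]: "a \<in> val_ring \<Longrightarrow> b \<in> val_ring \<Longrightarrow> a + b \<in> val_ring"
  using val_ring_diff[of a "- b"] by simp

lemma val_ring_power [simp]: "a \<in> val_ring \<Longrightarrow> a ^ n \<in> val_ring"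
  by (induction n) auto

lemma val_ring_sum: "(\<And>i. i \<in> A \<Longrightarrow> f i \<in> val_ring) \<Longrightarrow> sum f A \<in> val_ring"
  by (induction A rule: infinite_finite_induct) auto

lemma val_ring_of_nat [simp]: "of_nat n \<in> val_ring"
  by (induction n) auto

lemma val_ring_of_int [simp]: "of_int k \<in> val_ring"
  by (cases k rule: int_cases2) auto

lemma val_ring_numeral [simp]: "numeral n \<in> val_ring"
  using val_ring_of_nat[of "numeral n"] by simp

section \<open>An element or its inverse lies in the valuation ring\<close>

definition power_span :: "complex \<Rightarrow> nat \<Rightarrow> complex set" where
  "power_span a n = {\<Sum>i<n. c i * a ^ i | c. \<forall>i. c i \<in> val_ring}"

text \<open>The exponents are strictly below the bound, so the span of length 0 is trivial. This is
  where the descent below ends.\<close>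

lemma power_span_0: "x \<in> power_span a 0 \<Longrightarrow> x = 0"
  by (auto simp: power_span_def)

lemma power_span_add: "x \<in> power_span a n \<Longrightarrow> y \<in> power_span a n \<Longrightarrow> x + y \<in> power_span a n"
  unfolding power_span_def
proof clarify
  fix c d :: "nat \<Rightarrow> complex"
  assume "\<forall>i. c i \<in> val_ring" "\<forall>i. d i \<in> val_ring"
  thus "\<exists>e. (\<Sum>i<n. c i * a ^ i) + (\<Sum>i<n. d i * a ^ i) = (\<Sum>i<n. e i * a ^ i) \<and> (\<forall>i. e i \<in> val_ring)"
    by (intro exI[of _ "\<lambda>i. c i + d i"]) (auto simp: sum.distrib algebra_simps)
qed

lemma power_span_scale: "r \<in> val_ring \<Longrightarrow> x \<in> power_span a n \<Longrightarrow> r * x \<in> power_span a n"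
  unfolding power_span_def
proof clarify
  fix c :: "nat \<Rightarrow> complex"
  assume "r \<in> val_ring" "\<forall>i. c i \<in> val_ring"
  thus "\<exists>e. r * (\<Sum>i<n. c i * a ^ i) = (\<Sum>i<n. e i * a ^ i) \<and> (\<forall>i. e i \<in> val_ring)"
    by (intro exI[of _ "\<lambda>i. r * c i"]) (auto simp: sum_distrib_left algebra_simps)
qed

lemma power_span_power: "i < n \<Longrightarrow> a ^ i \<in> power_span a n"
  unfolding power_span_def
  by (intro CollectI exI[of _ "\<lambda>j. if j = i then 1 else 0"])
    (auto simp: if_distrib[of "\<lambda>x. x * _"] cong: if_cong)

lemma power_span_sum: "(\<And>i. i \<in> A \<Longrightarrow> f i \<in> power_span a n) \<Longrightarrow> sum f A \<in> power_span a n"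
proof (induction A rule: infinite_finite_induct)
  case (insert x F)
  thus ?case by (auto intro: power_span_add)
qed (auto simp: power_span_def intro!: exI[of _ "\<lambda>_. 0"])

lemma power_span_mono: "x \<in> power_span a n \<Longrightarrow> n \<le> k \<Longrightarrow> x \<in> power_span a k"
  unfolding power_span_def[of _ n]
  by (auto intro!: power_span_sum power_span_scale power_span_power)

lemma power_span_mult:
  assumes "x \<in> power_span a n" "y \<in> power_span a k"
  shows "x * y \<in> power_span a (n + k)"
proof -
  obtain c d where cd: "x = (\<Sum>i<n. c i * a ^ i)" "y = (\<Sum>j<k. d j * a ^ j)"
    "\<forall>i. c i \<in> val_ring" "\<forall>i. d i \<in> val_ring"
    using assms by (auto simp: power_span_def)
  have "x * y = (\<Sum>i<n. \<Sum>j<k. (c i * d j) * a ^ (i + j))"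
    unfolding cd by (simp add: sum_product power_add mult_ac)
  also have "\<dots> \<in> power_span a (n + k)"
    using cd by (intro power_span_sum power_span_scale power_span_power) auto
  finally show ?thesis .
qed

text \<open>The union of all spans is the ring generated by \<open>a\<close> over
  \<open>val_ring\<close>, a proper overring, so maximality puts 1/3 into it.\<close>

lemma third_in_power_span:
  assumes "a \<notin> val_ring"
  shows "\<exists>n. inverse 3 \<in> power_span a n"
proof -
  let ?R = "\<Union>n. power_span a n"
  have sub: "r \<in> power_span a 1" if "r \<in> val_ring" for r
    using power_span_scale[OF that power_span_power[of 0 1 a]] by simp
  have diff: "x - y \<in> ?R" if xy: "x \<in> power_span a n" "y \<in> power_span a k" for x y n k
  proof -
    have "x + (-1) * y \<in> power_span a (max n k)"
      by (rule power_span_add[OF power_span_mono[OF xy(1)] power_span_scale[OF _ power_span_mono[OF xy(2)]]]) auto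
    thus ?thesis by auto
  qed
  have "is_subring ?R" unfolding is_subring_def
  proof (intro conjI ballI)
    show "1 \<in> ?R" using sub[of 1] by auto
    fix x y assume "x \<in> ?R" "y \<in> ?R"
    then obtain n k where xy: "x \<in> power_span a n" "y \<in> power_span a k" by auto
    show "x - y \<in> ?R" by (rule diff[OF xy])
    show "x * y \<in> ?R" using power_span_mult[OF xy] by auto
  qed
  moreover have "val_ring \<subseteq> ?R" using sub by blast
  moreover have "a \<in> ?R" using power_span_power[of 1 2 a] by auto
  hence "?R \<noteq> val_ring" using assms by blast
  ultimately show ?thesis using val_ring_props(3)[of ?R] by blast
qed

text \<open>In other words, 3 lies in the Jacobson radical. If the inverse of u = 1 - 3d were
  missing, 1/3 would be a polynomial in 1/u. Multiplying by a power of u, which again has the form 1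
  - 3e, would put 1/3 into the ring.\<close>

lemma val_ring_inverse_one_minus:
  assumes d: "d \<in> val_ring"
  shows "1 - 3 * d \<noteq> 0" "inverse (1 - 3 * d) \<in> val_ring"
proof -
  define u where "u = 1 - 3 * d"
  show u0: "1 - 3 * d \<noteq> 0"
  proof
    assume "1 - 3 * d = 0"
    hence "inverse 3 = d" by (intro inverse_unique) simp
    thus False using d val_ring_props(2) by metis
  qed
  have pow: "\<exists>e\<in>val_ring. u ^ n = 1 - 3 * e" for n
  proof (induction n)
    case (Suc n)
    then obtain e where e: "e \<in> val_ring" "u ^ n = 1 - 3 * e" by blast
    have "u ^ Suc n = 1 - 3 * (d + e - 3 * d * e)"
      by (simp add: e(2)) (simp add: u_def algebra_simps)
    thus ?case using d e(1) by (intro bexI[of _ "d + e - 3 * d * e"]) auto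
  qed (auto intro: bexI[of _ 0])
  show "inverse (1 - 3 * d) \<in> val_ring"
  proof (rule ccontr)
    assume "inverse (1 - 3 * d) \<notin> val_ring"
    then obtain n where "inverse 3 \<in> power_span (inverse u) n"
      using third_in_power_span unfolding u_def by blast
    then obtain c where c: "inverse 3 = (\<Sum>i<n. c i * inverse u ^ i)" "\<forall>i. c i \<in> val_ring"
      by (auto simp: power_span_def)
    have "u ^ n * inverse 3 = (\<Sum>i<n. c i * u ^ (n - i))"
      unfolding c(1) sum_distrib_left
    proof (rule sum.cong)
      fix i assume "i \<in> {..<n}"
      hence "u ^ n = u ^ (n - i) * u ^ i" by (simp flip: power_add)
      thus "u ^ n * (c i * inverse u ^ i) = c i * u ^ (n - i)"
        using u0 by (simp add: u_def field_simps)
    qed simp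
    also have "\<dots> \<in> val_ring" using c(2) d by (intro val_ring_sum) (auto simp: u_def)
    finally have 1: "u ^ n * inverse 3 \<in> val_ring" .
    obtain e where e: "e \<in> val_ring" "u ^ n = 1 - 3 * e" using pow by blast
    have "inverse 3 = u ^ n * inverse 3 + e" by (simp add: e(2) field_simps)
    thus False using 1 e(1) val_ring_props(2) val_ring_add by metis
  qed
qed

text \<open>In the second relation the constant term is absorbed into the unit 1 - 3 *
  \<open>d 0\<close>, so 1 is a combination of negative powers of \<open>a\<close>. Multiplication
  by a^n expresses a^n by lower powers, with nonnegative exponents thanks to
  \<open>m \<le> n\<close>, and the top term of the first relation disappears.\<close>

lemma power_span_reduce:
  assumes a: "a \<noteq> 0" and 1: "inverse 3 \<in> power_span a (Suc n)"
    and 2: "inverse 3 \<in> power_span (inverse a) (Suc m)" and le: "m \<le> n"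
  shows "inverse 3 \<in> power_span a n"
proof -
  obtain c where c: "inverse 3 = (\<Sum>i<Suc n. c i * a ^ i)" "\<forall>i. c i \<in> val_ring"
    using 1 by (auto simp: power_span_def)
  obtain d where d: "inverse 3 = (\<Sum>i<Suc m. d i * inverse a ^ i)" "\<forall>i. d i \<in> val_ring"
    using 2 by (auto simp: power_span_def)
  have d0: "d 0 \<in> val_ring" using d by simp
  define v where "v = inverse (1 - 3 * d 0)"
  have v: "v \<in> val_ring" "v * (1 - 3 * d 0) = 1"
    using val_ring_inverse_one_minus[OF d0] by (auto simp: v_def)
  have "inverse 3 = d 0 + (\<Sum>i<m. d (Suc i) * inverse a ^ Suc i)"
    using d(1) by (simp add: sum.lessThan_Suc_shift del: sum.lessThan_Suc)
  hence "1 - 3 * d 0 = 3 * (\<Sum>i<m. d (Suc i) * inverse a ^ Suc i)"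
    by (simp add: field_simps)
  hence "1 = v * (3 * (\<Sum>i<m. d (Suc i) * inverse a ^ Suc i))" using v(2) by simp
  hence "a ^ n = a ^ n * (v * (3 * (\<Sum>i<m. d (Suc i) * inverse a ^ Suc i)))" by simp
  also have "\<dots> = (\<Sum>i<m. (3 * v * d (Suc i)) * (a ^ n * inverse a ^ Suc i))"
    by (simp add: sum_distrib_left mult_ac)
  also have "\<dots> = (\<Sum>i<m. (3 * v * d (Suc i)) * a ^ (n - Suc i))"
  proof (rule sum.cong)
    fix i assume "i \<in> {..<m}"
    hence "n = (n - Suc i) + Suc i" using le by simp
    hence "a ^ n = a ^ (n - Suc i) * a ^ Suc i" by (metis power_add)
    thus "(3 * v * d (Suc i)) * (a ^ n * inverse a ^ Suc i) = (3 * v * d (Suc i)) * a ^ (n - Suc i)"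
      using a by (simp add: field_simps)
  qed simp
  also have "\<dots> \<in> power_span a n"
    using le v d(2) by (intro power_span_sum power_span_scale power_span_power) auto
  finally have an: "a ^ n \<in> power_span a n" .
  have "(\<Sum>i<n. c i * a ^ i) \<in> power_span a n"
    using c(2) by (intro power_span_sum power_span_scale power_span_power) auto
  moreover have "c n * a ^ n \<in> power_span a n" using c(2) an by (intro power_span_scale) auto
  ultimately have "(\<Sum>i<Suc n. c i * a ^ i) \<in> power_span a n" using power_span_add by simp
  thus ?thesis unfolding c(1) .
qed

text \<open>Descent on the total length: the longer relation is shortened by the other, with
  \<open>a\<close> and its inverse exchanged if necessary. A relation of length 0 would say 1/3 =
  0.\<close>

lemma not_third_in_both_power_spans:
  "a \<noteq> 0 \<Longrightarrow> inverse 3 \<in> power_span a n \<Longrightarrow> inverse 3 \<in> power_span (inverse a) m \<Longrightarrow> False"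
proof (induction "n + m" arbitrary: a n m rule: less_induct)
  case less
  have pos: "n \<noteq> 0" "m \<noteq> 0"
    using less.prems power_span_0[of "inverse 3" a] power_span_0[of "inverse 3" "inverse a"]
    by (metis inverse_nonzero_iff_nonzero zero_neq_numeral)+
  then obtain n' m' where nm: "n = Suc n'" "m = Suc m'" by (meson not0_implies_Suc)
  show False
  proof (cases "m' \<le> n'")
    case True
    have "inverse 3 \<in> power_span a n'"
      using less.prems True nm by (intro power_span_reduce[of a n' m']) auto
    thus False using less.hyps[of n' m a] less.prems nm by simp
  next
    case False
    have "inverse 3 \<in> power_span (inverse a) m'"
      using less.prems False nm by (intro power_span_reduce[of "inverse a" m' n']) auto
    thus False using less.hyps[of n m' a] less.prems nm by simp
  qed
qed

lemma val_ring_total: "a \<in> val_ring \<or> inverse a \<in> val_ring"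
proof (cases "a = 0")
  case False
  thus ?thesis using third_in_power_span[of a] third_in_power_span[of "inverse a"]
      not_third_in_both_power_spans[of a] by blast
qed simp

text \<open>The nonunits. Zero is listed separately because \<open>inverse 0\<close> is 0, which
  lies in the ring.\<close>

definition val_ideal :: "complex set" where
  "val_ideal = {a \<in> val_ring. a = 0 \<or> inverse a \<notin> val_ring}"

lemma val_ideal_subset: "a \<in> val_ideal \<Longrightarrow> a \<in> val_ring"
  by (simp add: val_ideal_def)

lemma val_ideal_0 [simp]: "0 \<in> val_ideal" and val_ideal_1 [simp]: "1 \<notin> val_ideal"
  and val_ideal_3 [simp]: "3 \<in> val_ideal"
  using val_ring_props(2) by (auto simp: val_ideal_def)

lemma val_ideal_mult: 
  assumes "a \<in> val_ideal" "b \<in> val_ring"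
  shows "a * b \<in> val_ideal"
proof (rule ccontr)
  assume "a * b \<notin> val_ideal"
  hence ab: "a * b \<noteq> 0" "inverse (a * b) \<in> val_ring" using assms by (auto simp: val_ideal_def)
  have "inverse a = b * inverse (a * b)" using ab(1) by (simp add: field_simps)
  hence "inverse a \<in> val_ring" using assms(2) ab(2) val_ring_mult by metis
  thus False using assms ab by (auto simp: val_ideal_def)
qed

text \<open>One of \<open>a\<close>, \<open>b\<close> divides the other in a valuation ring, so the
  difference is a multiple of one of them.\<close>

lemma val_ideal_diff:
  assumes ab: "a \<in> val_ideal" "b \<in> val_ideal"
  shows "a - b \<in> val_ideal"
proof (cases "a = 0 \<or> b = 0")
  case True
  thus ?thesis using ab val_ideal_mult[of b "-1"] by auto
next
  case False
  have "a / b \<in> val_ring \<or> b / a \<in> val_ring" using val_ring_total[of "a / b"] by simp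
  thus ?thesis
  proof
    assume "a / b \<in> val_ring"
    hence "b * (a / b - 1) \<in> val_ideal" using ab by (intro val_ideal_mult) auto
    thus ?thesis using False by (simp add: algebra_simps)
  next
    assume "b / a \<in> val_ring"
    hence "a * (1 - b / a) \<in> val_ideal" using ab by (intro val_ideal_mult) auto
    thus ?thesis using False by (simp add: algebra_simps)
  qed
qed

lemma val_ideal_uminus: "a \<in> val_ideal \<Longrightarrow> - a \<in> val_ideal"
  using val_ideal_diff[of 0 a] by simp

lemma val_ideal_add: "a \<in> val_ideal \<Longrightarrow> b \<in> val_ideal \<Longrightarrow> a + b \<in> val_ideal"
  using val_ideal_diff[of a "- b"] val_ideal_uminus by simp

lemma val_ideal_inverse: "a \<notin> val_ring \<Longrightarrow> inverse a \<in> val_ideal"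
  using val_ring_total[of a] by (auto simp: val_ideal_def)

section \<open>The residue field\<close>

definition val_cong :: "complex \<Rightarrow> complex \<Rightarrow> bool" where
  "val_cong a b \<longleftrightarrow> a \<in> val_ring \<and> b \<in> val_ring \<and> a - b \<in> val_ideal"

text \<open>The relation is reflexive only on \<open>val_ring\<close>, so the partial quotient is
  the residue ring itself. Made into a type of class \<open>field\<close>, it gives access to the
  theory of roots of polynomials.\<close>

lemma part_equivp_val_cong: "part_equivp val_cong"
proof (rule part_equivpI)
  show "\<exists>a. val_cong a a" by (rule exI[of _ 0]) (simp add: val_cong_def)
  show "symp val_cong"
    by (rule sympI) (use val_ideal_uminus in \<open>force simp: val_cong_def\<close>)
  show "transp val_cong"
  proof (rule transpI)
    fix a b c assume "val_cong a b" "val_cong b c"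
    thus "val_cong a c" using val_ideal_add[of "a - b" "b - c"] by (simp add: val_cong_def)
  qed
qed

quotient_type resid = complex / partial: val_cong
  by (rule part_equivp_val_cong)

instantiation resid :: field
begin

lift_definition zero_resid :: resid is 0 by (simp add: val_cong_def)
lift_definition one_resid :: resid is 1 by (simp add: val_cong_def)
lift_definition plus_resid :: "resid \<Rightarrow> resid \<Rightarrow> resid" is "(+)"
  by (auto simp: val_cong_def add_diff_add intro: val_ideal_add)
lift_definition uminus_resid :: "resid \<Rightarrow> resid" is "uminus"
  using val_ideal_uminus by (fastforce simp: val_cong_def)
lift_definition minus_resid :: "resid \<Rightarrow> resid \<Rightarrow> resid" is "(-)"
proof -
  fix a b c d assume "val_cong a b" "val_cong c d"
  thus "val_cong (a - c) (b - d)"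
    using val_ideal_diff[of "a - b" "c - d"] by (simp add: val_cong_def algebra_simps)
qed
lift_definition times_resid :: "resid \<Rightarrow> resid \<Rightarrow> resid" is "(*)"
proof -
  fix a b c d assume *: "val_cong a b" "val_cong c d"
  have "(a - b) * c + (c - d) * b \<in> val_ideal"
    using * by (intro val_ideal_add val_ideal_mult) (auto simp: val_cong_def)
  thus "val_cong (a * c) (b * d)" using * by (simp add: val_cong_def algebra_simps)
qed
text \<open>On the ideal the value is the constant 0: it gives \<open>inverse 0 = 0\<close> in the
  quotient, while the inverse of a nonzero nonunit would leave the ring.\<close>

lift_definition inverse_resid :: "resid \<Rightarrow> resid" is "\<lambda>a. if a \<in> val_ideal then 0 else inverse a"
proof -
  fix a b assume *: "val_cong a b"
  have iff: "a \<in> val_ideal \<longleftrightarrow> b \<in> val_ideal"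
    using * val_ideal_diff[of a "a - b"] val_ideal_add[of "a - b" b] by (auto simp: val_cong_def)
  show "val_cong (if a \<in> val_ideal then 0 else inverse a) (if b \<in> val_ideal then 0 else inverse b)"
  proof (cases "a \<in> val_ideal")
    case False
    hence u: "a \<noteq> 0" "b \<noteq> 0" "inverse a \<in> val_ring" "inverse b \<in> val_ring"
      using * iff by (auto simp: val_cong_def val_ideal_def)
    have "(a - b) * - (inverse a * inverse b) \<in> val_ideal"
      using * u by (intro val_ideal_mult) (auto simp: val_cong_def)
    moreover have "(a - b) * - (inverse a * inverse b) = inverse a - inverse b"
      using u by (simp add: field_simps)
    ultimately show ?thesis using False iff u by (simp add: val_cong_def)
  qed (use iff in \<open>simp add: val_cong_def\<close>)
qed
definition divide_resid :: "resid \<Rightarrow> resid \<Rightarrow> resid" where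
  "divide_resid a b = a * inverse b"

instance
proof
  fix a b c :: resid
  show "a + b + c = a + (b + c)" "a + b = b + a" "0 + a = a" "- a + a = 0" "a - b = a + - b"
    "a * b * c = a * (b * c)" "a * b = b * a" "1 * a = a" "(a + b) * c = a * c + b * c"
    by (transfer; auto simp: val_cong_def algebra_simps)+
  show "(0::resid) \<noteq> 1" by transfer (auto simp: val_cong_def dest: val_ideal_uminus)
  show "inverse (0::resid) = 0" by transfer (auto simp: val_cong_def)
  show "a div b = a * inverse b" by (simp add: divide_resid_def)
  assume "a \<noteq> 0"
  thus "inverse a * a = 1" 
    by transfer (auto simp: val_cong_def val_ideal_def)
qed

end

text \<open>Total, with value 0 outside the ring, so that it can be mapped over the coefficients of
  any polynomial.\<close>

lift_definition res :: "complex \<Rightarrow> resid" is "\<lambda>a. if a \<in> val_ring then a else 0"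
  by (simp add: val_cong_def)

lemma res_0 [simp]: "res 0 = 0" and res_1 [simp]: "res 1 = 1"
  by (transfer; simp add: val_cong_def)+

lemma res_add: "a \<in> val_ring \<Longrightarrow> b \<in> val_ring \<Longrightarrow> res (a + b) = res a + res b"
  and res_mult: "a \<in> val_ring \<Longrightarrow> b \<in> val_ring \<Longrightarrow> res (a * b) = res a * res b"
  and res_uminus: "a \<in> val_ring \<Longrightarrow> res (- a) = - res a"
  by (transfer; simp add: val_cong_def)+

lemma res_eq_0_iff: "a \<in> val_ring \<Longrightarrow> res a = 0 \<longleftrightarrow> a \<in> val_ideal"
  by transfer (auto simp: val_cong_def)

lemma res_power: "a \<in> val_ring \<Longrightarrow> res (a ^ n) = res a ^ n"
  by (induction n) (auto simp: res_mult)

lemma res_sum: "(\<And>i. i \<in> A \<Longrightarrow> f i \<in> val_ring) \<Longrightarrow> res (sum f A) = (\<Sum>i\<in>A. res (f i))"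
  by (induction A rule: infinite_finite_induct) (auto simp: res_add val_ring_sum)

lemma res_of_nat [simp]: "res (of_nat n) = of_nat n"
  by (induction n) (auto simp: res_add)

lemma res_of_int [simp]: "res (of_int k) = of_int k"
  by (cases k rule: int_cases2) (auto simp: res_uminus)

lemma resid_3: "(3 :: resid) = 0"
proof -
  have "res (of_nat 3) = 0" by (subst res_eq_0_iff) auto
  thus ?thesis by (simp only: res_of_nat) simp
qed

section \<open>Reduction of rational characteristic polynomials\<close>

definition val_poly :: "complex poly \<Rightarrow> bool" where
  "val_poly p \<longleftrightarrow> (\<forall>i. coeff p i \<in> val_ring)"

lemma coeff_map_poly_res [simp]: "coeff (map_poly res p) i = res (coeff p i)"
  by (simp add: coeff_map_poly)

lemma val_poly_mult: "val_poly p \<Longrightarrow> val_poly q \<Longrightarrow> val_poly (p * q)"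
  by (auto simp: val_poly_def coeff_mult intro!: val_ring_sum)

lemma map_poly_res_mult:
  assumes "val_poly p" "val_poly q"
  shows "map_poly res (p * q) = map_poly res p * map_poly res q"
  by (rule poly_eqI) (use assms in \<open>simp add: coeff_mult res_sum res_mult val_poly_def\<close>)

lemma map_poly_res_prod:
  assumes "\<And>i. i \<in> A \<Longrightarrow> val_poly (f i)"
  shows "val_poly (prod f A) \<and> map_poly res (prod f A) = (\<Prod>i\<in>A. map_poly res (f i))"
  using assms
proof (induction A rule: infinite_finite_induct)
  case (insert x F)
  thus ?case by (simp add: map_poly_res_mult val_poly_mult)
qed (auto simp: val_poly_def coeff_1 intro!: poly_eqI)

text \<open>By Bezout d u + 3 v = 1, so d u = 1 - 3v is a unit, and the residue of 1/d is that of
  the integer u.\<close>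

lemma val_unit_int:
  assumes "\<not> 3 dvd (d :: int)"
  shows "of_int d \<noteq> (0 :: complex)" "inverse (of_int d) \<in> val_ring" "\<exists>t::int. res (inverse (of_int d)) = of_int t"
proof -
  show d0: "of_int d \<noteq> (0 :: complex)" using assms by auto
  have "coprime d 3" using assms prime_imp_coprime[of "3::int" d]
    by (simp add: coprime_commute)
  then obtain u v where uv: "d * u + 3 * v = 1" using bezout_int[of d 3] by (metis coprime_iff_gcd_eq_1 mult.commute)
  hence "of_int d * of_int u = (1 - 3 * of_int v :: complex)"
    by (metis (no_types, lifting) add_diff_cancel_right' of_int_1 of_int_add of_int_mult of_int_numeral)
  moreover note val_ring_inverse_one_minus[of "of_int v"]
  ultimately have "inverse (of_int d * of_int u :: complex) \<in> val_ring" "of_int d * of_int u \<noteq> (0::complex)" by simp_all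
  hence "of_int u * inverse (of_int d * of_int u :: complex) \<in> val_ring" by (intro val_ring_mult) auto
  also have "of_int u * inverse (of_int d * of_int u :: complex) = inverse (of_int d)"
    using \<open>of_int d * of_int u \<noteq> (0::complex)\<close> by (simp add: field_simps)
  finally show inv: "inverse (of_int d :: complex) \<in> val_ring" .
  have "of_int (d * u + 3 * v) = (1 :: resid)" by (simp only: uv of_int_1)
  hence "of_int d * of_int u = (1 :: resid)" using resid_3 by simp
  moreover have "res (inverse (of_int d) * of_int d) = 1" using d0 by simp
  hence "res (inverse (of_int d)) * of_int d = 1" using inv by (subst (asm) res_mult) auto
  ultimately have "res (inverse (of_int d)) = of_int u"
    by (metis mult.assoc mult_1 mult_1_right)
  thus "\<exists>t::int. res (inverse (of_int d)) = of_int t" by blast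
qed

lemma int_three_decomp:
  assumes "(s::int) \<noteq> 0"
  obtains e s' where "s = 3 ^ e * s'" "\<not> 3 dvd s'"
proof (rule multiplicity_decompose'[of s 3])
  show "s \<noteq> 0" by (fact assms)
qed (use that in auto)

text \<open>Different powers of 3 have different valuations. No more than this is needed about the
  value group.\<close>

lemma power_3_quotient_unit:
  assumes "(3::complex) ^ A / 3 ^ B \<in> val_ring" "(3::complex) ^ A / 3 ^ B \<notin> val_ideal"
  shows "A = B"
proof (rule ccontr)
  assume "A \<noteq> B"
  have pow: "3 ^ Suc n \<in> val_ideal" for n using val_ideal_mult[of 3 "3 ^ n"] by simp
  consider "A > B" | "B > A" using \<open>A \<noteq> B\<close> by linarith
  thus False
  proof cases
    case 1
    then obtain n where "A = B + Suc n" using less_natE by (metis add_Suc_right)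
    hence "(3::complex) ^ A / 3 ^ B = 3 ^ Suc n" by (simp add: power_add)
    thus False using assms pow by metis
  next
    case 2
    then obtain n where "B = A + Suc n" using less_natE by (metis add_Suc_right)
    hence "inverse ((3::complex) ^ A / 3 ^ B) = 3 ^ Suc n" by (simp add: power_add)
    moreover have "inverse ((3::complex) ^ A / 3 ^ B) \<notin> val_ideal"
      using assms by (auto simp: val_ideal_def)
    ultimately show False using pow by metis
  qed
qed

text \<open>The valuation of a rational number is an integer and that of w is k/b in lowest terms.
  So \<open>x\<close> can be a unit only if j and J agree mod b; the powers of w then contribute a
  power of 3, which cancels against that in q, and \<open>x\<close> is a quotient of integers prime
  to 3.\<close>

lemma res_rational_times_root:
  fixes w :: complex
  assumes w: "w ^ b = 3 ^ k" and cop: "coprime k b" and b: "b > 0"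
    and x: "x = of_rat q * w ^ j / w ^ J" "x \<in> val_ring"
  shows "\<exists>t::int. res x = of_int t \<and> (t \<noteq> 0 \<longrightarrow> j mod b = J mod b)"
proof (cases "x \<in> val_ideal")
  case True
  thus ?thesis using x(2) by (intro exI[of _ 0]) (simp add: res_eq_0_iff)
next
  case False
  have w0: "w \<noteq> 0" using w b by (cases "w = 0") (auto simp: power_0_left)
  have "q \<noteq> 0" using False x by auto
  obtain s d where q: "quotient_of q = (s, d)" by force
  have d: "d \<noteq> 0" using quotient_of_denom_pos[OF q] by simp
  have qq: "q = of_int s / of_int d" by (rule quotient_of_div[OF q])
  have s: "s \<noteq> 0" using qq \<open>q \<noteq> 0\<close> by auto
  obtain e1 s' where s': "s = 3 ^ e1 * s'" "\<not> 3 dvd s'" using int_three_decomp[OF s] .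
  obtain e2 d' where d': "d = 3 ^ e2 * d'" "\<not> 3 dvd d'" using int_three_decomp[OF d] .
  define y :: complex where "y = of_int s' / of_int d'"
  note us = val_unit_int[OF s'(2)] and ud = val_unit_int[OF d'(2)]
  have y: "y \<in> val_ring" "inverse y \<in> val_ring" "y \<noteq> 0"
    using us ud by (auto simp: y_def divide_inverse)
  have "(of_rat q :: complex) = of_int s / of_int d" by (simp add: qq of_rat_divide)
  hence xy: "x = y * (3 ^ e1 * w ^ j) / (3 ^ e2 * w ^ J)" unfolding x(1) s' d' y_def by (simp add: mult_ac)
  \<comment> \<open>The b-th power turns w into powers of 3, so that only those have to be
    compared.\<close>
  have "x ^ b = y ^ b * (3 ^ (e1 * b) * (w ^ b) ^ j) / (3 ^ (e2 * b) * (w ^ b) ^ J)"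
    unfolding xy by (simp add: power_mult_distrib power_divide mult.commute flip: power_mult)
  also have "\<dots> = y ^ b * (3 ^ (e1 * b + k * j) / 3 ^ (e2 * b + k * J))"
    unfolding w by (simp add: power_add flip: power_mult)
  finally have "3 ^ (e1 * b + k * j) / 3 ^ (e2 * b + k * J) = x ^ b * inverse y ^ b"
    using y(3) by (simp add: field_simps)
  moreover have "x ^ b * inverse y ^ b \<in> val_ring" using x(2) y by simp
  moreover have "x ^ b * inverse y ^ b \<notin> val_ideal"
  proof -
    have "res (x ^ b * inverse y ^ b) = res x ^ b * res (inverse y) ^ b"
      using x(2) y by (simp add: res_mult res_power)
    moreover have "res x \<noteq> 0" using False x(2) by (simp add: res_eq_0_iff)
    moreover have "res (inverse y) \<noteq> 0" using y by (simp add: res_eq_0_iff val_ideal_def)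
    ultimately have "res (x ^ b * inverse y ^ b) \<noteq> 0" by simp
    thus ?thesis using x(2) y by (simp add: res_eq_0_iff)
  qed
  ultimately have eq: "e1 * b + k * j = e2 * b + k * J" using power_3_quotient_unit by metis
  have jJ: "j mod b = J mod b"
  proof -
    have "(k * j) mod b = (k * J) mod b" using eq by (metis mod_mult_self3 mult.commute)
    hence "[k * j = k * J] (mod b)" by (simp add: cong_def)
    hence "[j = J] (mod b)" using cop by (simp add: cong_mult_lcancel_nat)
    thus ?thesis by (simp add: cong_def)
  qed
  \<comment> \<open>Equality of the exponents after the b-th power would fix the two sides only up
    to a root of unity. Splitting off the common remainder mod b gives equality itself.\<close>
  have "3 ^ e1 * w ^ j = 3 ^ e2 * w ^ J"
  proof -
    define r where "r = j mod b"
    have j: "j = b * (j div b) + r" "J = b * (J div b) + r" using jJ by (metis mult_div_mod_eq r_def)+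
    have "w ^ j = 3 ^ (k * (j div b)) * w ^ r"
      by (subst j(1)) (simp only: power_add power_mult w)
    moreover have "w ^ J = 3 ^ (k * (J div b)) * w ^ r"
      by (subst j(2)) (simp only: power_add power_mult w)
    moreover have "e1 + k * (j div b) = e2 + k * (J div b)"
    proof -
      have "b * (e1 + k * (j div b)) + k * r = b * (e2 + k * (J div b)) + k * r"
        using eq by (subst (asm) j(1), subst (asm) j(2)) (simp add: algebra_simps)
      thus ?thesis using b by simp
    qed
    ultimately show ?thesis by (metis mult.assoc power_add)
  qed
  hence "x = y" unfolding xy using w0 by simp
  moreover obtain t where "res (inverse (of_int d')) = of_int t" using ud(3) by blast
  hence "res y = of_int (s' * t)" using ud(2) by (simp add: y_def divide_inverse res_mult)
  ultimately show ?thesis using jJ by blast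
qed

section \<open>Counting the roots of T^r Q(T^b)\<close>

lemma coeff_pcompose_monom:
  assumes "b > 0"
  shows "coeff (pcompose p (monom 1 b)) n = (if b dvd n then coeff p (n div b) else (0 :: 'a :: comm_ring_1))"
proof (induction p arbitrary: n)
  case (pCons a p)
  have "coeff (pcompose (pCons a p) (monom 1 b)) n
      = (if n = 0 then a else 0) + (if n < b then 0 else coeff (pcompose p (monom 1 b)) (n - b))"
    by (simp add: pcompose_pCons coeff_monom_mult coeff_pCons split: nat.split)
  also have "\<dots> = (if b dvd n then coeff (pCons a p) (n div b) else 0)"
  proof (cases "n < b")
    case True
    thus ?thesis using assms by (auto simp: dvd_imp_le dest: dvd_imp_le)
  next
    case False
    have "b dvd n - b \<longleftrightarrow> b dvd n" using False dvd_minus_self by auto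
    moreover have "n div b = Suc ((n - b) div b)" using False assms by (simp add: le_div_geq)
    ultimately show ?thesis using False assms pCons by auto
  qed
  finally show ?case .
qed simp

lemma degree_pcompose_monom:
  "b > 0 \<Longrightarrow> degree (pcompose p (monom 1 b)) = b * degree (p :: 'a :: idom poly)"
  by (simp add: degree_pcompose degree_monom_eq mult.commute)

text \<open>Without its factor T^s, Q is a polynomial H with H(0) nonzero. The nonzero roots are
  exactly those of H(T^b), and as the polynomial splits, their number is its degree b * deg
  H.\<close>

lemma dvd_card_nonzero_roots:
  fixes Q :: "'a :: field poly"
  assumes b: "b > 0" and Q: "Q \<noteq> 0"
    and split: "size (proots (monom 1 r * pcompose Q (monom 1 b)))
      = degree (monom 1 r * pcompose Q (monom 1 b))"
  shows "b dvd size (filter_mset (\<lambda>x. x \<noteq> 0) (proots (monom 1 r * pcompose Q (monom 1 b))))"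
proof -
  obtain H where H: "Q = [:- 0, 1:] ^ order 0 Q * H" "\<not> [:- 0, 1:] dvd H"
    using order_decomp[OF Q] by blast
  have H0: "poly H 0 \<noteq> 0" using H(2) by (simp add: poly_eq_0_iff_dvd)
  define N where "N = r + b * order 0 Q"
  have mon: "monom 1 n = ([:0, 1:] :: 'a poly) ^ n" for n by (simp add: monom_altdef)
  have pc: "pcompose ([:0, 1:] ^ n) (monom 1 b) = ([:0, 1:] :: 'a poly) ^ (b * n)" for n
    by (induction n) (simp_all add: pcompose_mult pcompose_pCons pcompose_1 mon power_add flip: one_pCons)
  have eq: "monom 1 r * pcompose Q (monom 1 b) = [:0, 1:] ^ N * pcompose H (monom 1 b)"
    by (subst H(1)) (simp add: pcompose_mult pc N_def power_add mon[of r] mult.assoc)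
  let ?H = "pcompose H (monom 1 b)"
  have "poly ?H 0 = poly H 0" using b by (simp add: poly_pcompose poly_monom power_0_left)
  hence nz: "?H \<noteq> 0" "poly ?H 0 \<noteq> 0" using H0 by auto
  have pr: "proots ([:0, 1:] ^ N * ?H) = repeat_mset N {#0#} + proots ?H"
    using nz by (subst proots_mult) (auto simp: proots_power)
  have "degree ([:0, 1:] ^ N * ?H) = N + degree ?H"
    using nz by (simp add: degree_mult_eq degree_power_eq)
  hence "size (proots ?H) = degree ?H" using split unfolding eq pr by simp
  moreover have "filter_mset (\<lambda>x. x \<noteq> 0) (proots ([:0, 1:] ^ N * ?H)) = proots ?H"
  proof -
    have "filter_mset (\<lambda>x. x \<noteq> 0) (proots ?H) = proots ?H"
      using nz by (auto simp: filter_mset_eq_conv)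
    moreover have "filter_mset (\<lambda>x. x \<noteq> 0) (repeat_mset N {#0::'a#}) = {#}"
      by (induction N) auto
    ultimately show ?thesis unfolding pr by simp
  qed
  ultimately show ?thesis unfolding eq by (metis degree_pcompose_monom[OF b] dvd_triv_left)
qed

text \<open>The hypothesis on \<open>F\<close> is what irreducibility of g over a subfield would
  give: a member of \<open>F\<close> sharing a root with g is divisible by g within
  \<open>F\<close>. As long as some counted root is left, a factor g(T^b) of degree b * deg g is
  removed, all of whose roots are counted.\<close>

lemma dvd_card_roots_power:
  fixes g :: "'a :: field poly" and F :: "'a poly set"
  assumes b: "b > 0" and g: "degree g > 0" "poly g 0 \<noteq> 0"
    and F: "\<And>Q x. Q \<in> F \<Longrightarrow> poly Q x = 0 \<Longrightarrow> poly g x = 0 \<Longrightarrow> \<exists>Q1\<in>F. Q = g * Q1"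
  shows "Q \<in> F \<Longrightarrow> Q \<noteq> 0 \<Longrightarrow> size (proots (monom 1 r * pcompose Q (monom 1 b)))
      = degree (monom 1 r * pcompose Q (monom 1 b)) \<Longrightarrow>
     b * degree g dvd size (filter_mset (\<lambda>x. poly g (x ^ b) = 0) (proots (monom 1 r * pcompose Q (monom 1 b))))"
proof (induction "degree Q" arbitrary: Q rule: less_induct)
  case less
  let ?P = "\<lambda>Q. monom 1 r * pcompose Q (monom 1 b)"
  let ?f = "filter_mset (\<lambda>x. poly g (x ^ b) = 0)"
  have pc0: "pcompose q (monom 1 b) \<noteq> 0" if "q \<noteq> 0" for q :: "'a poly"
  proof -
    have "coeff (pcompose q (monom 1 b)) (b * degree q) \<noteq> 0"
      using that b by (simp add: coeff_pcompose_monom)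
    thus ?thesis by auto
  qed
  have P0: "?P q \<noteq> 0" if "q \<noteq> 0" for q :: "'a poly" using pc0[OF that] by simp
  show ?case
  proof (cases "?f (proots (?P Q)) = {#}")
    case False
    then obtain x where "x \<in># ?f (proots (?P Q))" using multiset_nonemptyE by blast
    hence x: "x \<in># proots (?P Q)" "poly g (x ^ b) = 0" by simp_all
    have "x \<noteq> 0" using x(2) g(2) b by (auto simp: power_0_left)
    moreover have "poly (?P Q) x = 0" using x(1) P0[OF less.prems(2)] by simp
    ultimately have "poly Q (x ^ b) = 0" by (simp add: poly_monom poly_pcompose)
    then obtain Q1 where Q1: "Q1 \<in> F" "Q = g * Q1" using F[OF less.prems(1) _ x(2)] by blast
    have nz: "g \<noteq> 0" "Q1 \<noteq> 0" using Q1 less.prems by auto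
    let ?h = "pcompose g (monom 1 b)"
    have eq: "?P Q = ?h * ?P Q1" unfolding Q1(2) by (simp add: pcompose_mult mult_ac)
    have pr: "proots (?P Q) = proots ?h + proots (?P Q1)"
      unfolding eq using P0[OF nz(2)] pc0[OF nz(1)] by (intro proots_mult)
    have "degree (?P Q) = degree ?h + degree (?P Q1)"
      unfolding eq using P0[OF nz(2)] pc0[OF nz(1)] by (intro degree_mult_eq)
    \<comment> \<open>Both factors split: neither has more roots than its degree, and the totals
      agree.\<close>
    hence sz: "size (proots ?h) = degree ?h" "size (proots (?P Q1)) = degree (?P Q1)"
      using less.prems(3) pr size_proots_le[of ?h] size_proots_le[of "?P Q1"] by simp_all
    have "?f (proots ?h) = proots ?h"
      using pc0[OF nz(1)] by (auto simp: filter_mset_eq_conv poly_pcompose poly_monom)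
    hence "size (?f (proots (?P Q))) = b * degree g + size (?f (proots (?P Q1)))"
      unfolding pr using sz(1) degree_pcompose_monom[OF b, of g] by simp
    moreover have "degree Q1 < degree Q" using Q1(2) nz g(1) by (simp add: degree_mult_eq)
    hence "b * degree g dvd size (?f (proots (?P Q1)))"
      using less.hyps[OF _ Q1(1) nz(2) sz(2)] by simp
    ultimately show ?thesis by simp
  next
    case True
    show ?thesis unfolding True by simp
  qed
qed


text \<open>Each linear factor w T - a_i is normalised so that its reduction is nonzero, and
  conjugates with a_i/w outside the ring reduce to constants. Up to a common constant the
  coefficients of the product are w^j times rational numbers, so those of maximal size sit in one
  class of exponents mod b.\<close>

lemma residue_char_poly:
  fixes a :: "nat \<Rightarrow> complex" and w :: complex
  assumes char: "(\<Prod>i<n. [:- a i, 1:]) = map_poly of_rat q"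
    and w: "w ^ b = 3 ^ k" and cop: "coprime k b" and b: "b > 0"
  defines "S \<equiv> {i. i < n \<and> a i / w \<in> val_ring}"
  shows "\<exists>c r Q. c \<noteq> 0 \<and> Q \<noteq> 0 \<and> (\<forall>i. coeff Q i \<in> \<int>) \<and>
    smult c (\<Prod>i\<in>S. [:- res (a i / w), 1:]) = monom 1 r * pcompose Q (monom 1 b)"
proof -
  have w0: "w \<noteq> 0" using w b by (cases "w = 0") (auto simp: power_0_left)
  \<comment> \<open>Outside \<open>S\<close> the quotient w / a_i is a nonunit, so this factor
    reduces to -1.\<close>
  define f where "f i = (if i \<in> S then [:- (a i / w), 1:] else [:- 1, w / a i:])" for i
  define \<kappa> where "\<kappa> i = (if i \<in> S then 1 / w else 1 / a i)" for i
  have a0: "a i \<noteq> 0" if "i < n" "i \<notin> S" for i using that by (auto simp: S_def)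
  have id: "w / a i \<in> val_ideal" if "i < n" "i \<notin> S" for i
    using that val_ideal_inverse[of "a i / w"] by (auto simp: S_def)
  have f1: "val_poly (f i)" if "i < n" for i
    using that id[of i] by (auto simp: f_def val_poly_def coeff_pCons S_def val_ideal_subset split: nat.split)
  have f2: "map_poly res (f i) = (if i \<in> S then [:- res (a i / w), 1:] else [:- 1:])" if "i < n" for i
    using that id[of i]
    by (intro poly_eqI)
      (auto simp: f_def S_def coeff_pCons res_uminus res_eq_0_iff val_ideal_subset split: nat.split)
  have f3: "f i = smult (\<kappa> i) (pcompose [:- a i, 1:] [:0, w:])" if "i < n" for i
    using that a0[of i] w0 by (auto simp: f_def \<kappa>_def pcompose_pCons)
  define P where "P = (\<Prod>i<n. f i)"
  define G where "G = map_poly res P"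
  have PG: "val_poly P" "G = (\<Prod>i<n. map_poly res (f i))"
    using map_poly_res_prod[of "{..<n}" f] f1 by (auto simp: P_def G_def)
  have S: "S \<subseteq> {..<n}" by (auto simp: S_def)
  define \<epsilon> :: resid where "\<epsilon> = (- 1) ^ card ({..<n} - S)"
  have \<epsilon>: "\<epsilon> \<noteq> 0" by (simp add: \<epsilon>_def)
  have G: "G = smult \<epsilon> (\<Prod>i\<in>S. [:- res (a i / w), 1:])"
  proof -
    have "G = (\<Prod>i\<in>S. map_poly res (f i)) * (\<Prod>i\<in>{..<n} - S. map_poly res (f i))"
      unfolding PG(2) using prod.subset_diff[OF S, of "\<lambda>i. map_poly res (f i)"] by (simp add: mult.commute)
    also have "(\<Prod>i\<in>S. map_poly res (f i)) = (\<Prod>i\<in>S. [:- res (a i / w), 1:])"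
      by (rule prod.cong) (use S in \<open>auto simp: f2\<close>)
    also have "(\<Prod>i\<in>{..<n} - S. map_poly res (f i)) = (\<Prod>i\<in>{..<n} - S. [:- 1:])"
      by (rule prod.cong) (auto simp: f2)
    also have "\<dots> = [:\<epsilon>:]" by (simp add: \<epsilon>_def poly_const_pow)
    finally show ?thesis by simp
  qed
  have G0: "G \<noteq> 0" using \<epsilon> S finite_subset[OF S] unfolding G by simp
  define K where "K = (\<Prod>i<n. \<kappa> i)"
  have K0: "K \<noteq> 0" using a0 w0 by (auto simp: K_def \<kappa>_def)
  have pc: "pcompose (\<Prod>i\<in>A. g i) h = (\<Prod>i\<in>A. pcompose (g i) h)" for g :: "nat \<Rightarrow> complex poly" and h A
    by (induction A rule: infinite_finite_induct) (auto simp: pcompose_mult pcompose_1)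
  have "P = smult K (pcompose (\<Prod>i<n. [:- a i, 1:]) [:0, w:])"
    unfolding P_def K_def pc prod_smult[symmetric] by (rule prod.cong) (auto simp: f3)
  hence cP: "coeff P j = K * (w ^ j * of_rat (coeff q j))" for j
    by (simp add: char coeff_pcompose_linear coeff_map_poly)
  \<comment> \<open>At the degree of the reduction the coefficient \<open>u\<close> of
    \<open>P\<close> is a unit. Dividing by it cancels the unknown constant \<open>K\<close> and
    leaves a rational multiple of w^j / w^J.\<close>
  define J where "J = degree G"
  define u where "u = coeff P J"
  have ru: "res u \<noteq> 0" using G0 unfolding u_def J_def by (metis G_def coeff_map_poly_res leading_coeff_0_iff)
  have u: "u \<in> val_ring" "u \<noteq> 0" "inverse u \<in> val_ring"
  proof -
    show "u \<in> val_ring" using PG(1) by (simp add: val_poly_def u_def)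
    thus "u \<noteq> 0" "inverse u \<in> val_ring" using ru by (auto simp: res_eq_0_iff val_ideal_def)
  qed
  have "\<exists>t::int. res (coeff P j * inverse u) = of_int t \<and> (t \<noteq> 0 \<longrightarrow> j mod b = J mod b)" for j
  proof (rule res_rational_times_root[OF w cop b])
    have "coeff q J \<noteq> 0" using u(2) by (auto simp: u_def cP)
    thus "coeff P j * inverse u = of_rat (coeff q j / coeff q J) * w ^ j / w ^ J"
      using K0 w0 by (simp add: u_def cP of_rat_divide field_simps)
    show "coeff P j * inverse u \<in> val_ring" using PG(1) u by (simp add: val_poly_def)
  qed
  then obtain t :: "nat \<Rightarrow> int" where t: "\<And>j. res (coeff P j * inverse u) = of_int (t j)"
    "\<And>j. t j \<noteq> 0 \<Longrightarrow> j mod b = J mod b" by metis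
  have cG: "coeff G j = res u * of_int (t j)" for j
  proof -
    have "coeff P j * inverse u \<in> val_ring" using PG(1) u by (simp add: val_poly_def)
    hence "res (u * (coeff P j * inverse u)) = res u * of_int (t j)" using u by (simp add: res_mult t)
    moreover have "u * (coeff P j * inverse u) = coeff P j" using u(2) by simp
    ultimately show ?thesis by (simp add: G_def)
  qed
  define r where "r = J mod b"
  \<comment> \<open>The range up to \<open>J\<close> is generous: already for l > J the exponent r +
    b * l exceeds the degree of \<open>G\<close>.\<close>
  define Q :: "resid poly" where "Q = (\<Sum>l\<le>J. monom (of_int (t (r + b * l))) l)"
  have cQ: "coeff Q l = (if l \<le> J then of_int (t (r + b * l)) else 0)" for l
    by (auto simp: Q_def coeff_sum)
  have eq: "smult (inverse (res u) * \<epsilon>) (\<Prod>i\<in>S. [:- res (a i / w), 1:]) = monom 1 r * pcompose Q (monom 1 b)"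
  proof -
    have "smult (inverse (res u)) G = monom 1 r * pcompose Q (monom 1 b)"
    proof (rule poly_eqI)
      fix j
      have L: "coeff (smult (inverse (res u)) G) j = of_int (t j)" using ru by (simp add: cG)
      have R: "coeff (monom 1 r * pcompose Q (monom 1 b)) j =
          (if j < r then 0 else if b dvd j - r then coeff Q ((j - r) div b) else 0)"
        using b by (simp add: coeff_monom_mult coeff_pcompose_monom)
      show "coeff (smult (inverse (res u)) G) j = coeff (monom 1 r * pcompose Q (monom 1 b)) j"
      proof (cases "j mod b = r")
        case True
        hence j: "j \<ge> r" "b dvd j - r" "r + b * ((j - r) div b) = j"
          using mod_less_eq_dividend[of j b] by (auto simp: minus_mod_eq_div_mult[symmetric] dvd_minus_mod)
        have "coeff Q ((j - r) div b) = of_int (t j)"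
        proof (cases "(j - r) div b \<le> J")
          case False
          have "(j - r) div b \<le> j" by (metis diff_le_self div_le_dividend le_trans)
          hence "J < j" using False by simp
          hence "coeff G j = 0" by (simp add: J_def coeff_eq_0)
          thus ?thesis using False ru by (simp add: cQ cG)
        qed (simp add: cQ j)
        thus ?thesis using j unfolding L R by simp
      next
        case False
        hence "t j = 0" using t(2)[of j] by (auto simp: r_def)
        moreover have "\<not> b dvd j - r" if "j \<ge> r"
        proof
          assume "b dvd j - r"
          then obtain l where "j - r = b * l" by (elim dvdE)
          hence "j = r + b * l" using that by simp
          thus False using False b by (simp add: r_def)
        qed
        ultimately show ?thesis unfolding L R by simp
      qed
    qed
    thus ?thesis unfolding G by simp
  qed
  have "Q \<noteq> 0"
  proof
    assume "Q = 0"
    hence "smult (inverse (res u)) G = 0" using eq unfolding G by simp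
    thus False using G0 ru by simp
  qed
  moreover have "\<forall>i. coeff Q i \<in> \<int>" by (simp add: cQ)
  moreover have "inverse (res u) * \<epsilon> \<noteq> 0" using ru \<epsilon> by simp
  ultimately show ?thesis using eq by blast
qed

section \<open>Division by T + 1 and T^2 + 1 over the prime field\<close>

lemma Ints_poly_div_linear:
  fixes Q :: "'a :: comm_ring_1 poly"
  shows "\<forall>i. coeff Q i \<in> \<int> \<Longrightarrow> \<exists>Q1 u. Q = [:1, 1:] * Q1 + [:u:] \<and> (\<forall>i. coeff Q1 i \<in> \<int>) \<and> u \<in> \<int>"
proof (induction Q)
  case 0
  show ?case by (rule exI[of _ 0], rule exI[of _ 0]) simp
next
  case (pCons a Q)
  have a: "a \<in> \<int>" and Q: "\<forall>i. coeff Q i \<in> \<int>"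
    using pCons.prems coeff_pCons_0[of a Q] coeff_pCons_Suc[of a Q] by metis+
  obtain Q1 u where IH: "Q = [:1, 1:] * Q1 + [:u:]" "\<forall>i. coeff Q1 i \<in> \<int>" "u \<in> \<int>"
    using pCons.IH[OF Q] by blast
  have "pCons a Q = [:1, 1:] * pCons u Q1 + [:a - u:]" by (simp add: IH(1))
  moreover have "\<forall>i. coeff (pCons u Q1) i \<in> \<int>" using IH by (simp add: coeff_pCons split: nat.split)
  ultimately show ?case using a IH(3) by (metis Ints_diff)
qed

text \<open>The divisor is monic, so quotient and remainder stay over the subring
  \<open>\<int>\<close>. In \<open>resid\<close> this is the prime field, which thus needs no type
  of its own.\<close>

lemma Ints_poly_div_quadratic:
  fixes Q :: "'a :: comm_ring_1 poly"
  shows "\<forall>i. coeff Q i \<in> \<int> \<Longrightarrow>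
    \<exists>Q1 u v. Q = [:1, 0, 1:] * Q1 + [:u, v:] \<and> (\<forall>i. coeff Q1 i \<in> \<int>) \<and> u \<in> \<int> \<and> v \<in> \<int>"
proof (induction Q)
  case 0
  show ?case by (rule exI[of _ 0], rule exI[of _ 0], rule exI[of _ 0]) simp
next
  case (pCons a Q)
  have a: "a \<in> \<int>" and Q: "\<forall>i. coeff Q i \<in> \<int>"
    using pCons.prems coeff_pCons_0[of a Q] coeff_pCons_Suc[of a Q] by metis+
  obtain Q1 u v where IH: "Q = [:1, 0, 1:] * Q1 + [:u, v:]" "\<forall>i. coeff Q1 i \<in> \<int>" "u \<in> \<int>" "v \<in> \<int>"
    using pCons.IH[OF Q] by blast
  have "pCons a Q = [:1, 0, 1:] * pCons v Q1 + [:a - v, u:]" by (simp add: IH(1))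
  moreover have "\<forall>i. coeff (pCons v Q1) i \<in> \<int>" using IH by (simp add: coeff_pCons split: nat.split)
  ultimately show ?case using a IH(3,4) by (metis Ints_diff)
qed

lemma resid_of_int_eq_0_iff: "of_int k = (0 :: resid) \<longleftrightarrow> 3 dvd k"
proof
  assume "of_int k = (0 :: resid)"
  hence "of_int k \<in> val_ideal" using res_eq_0_iff[of "of_int k"] by simp
  thus "3 dvd k" using val_unit_int[of k] by (auto simp: val_ideal_def)
next
  assume "3 dvd k"
  thus "of_int k = (0 :: resid)" by (auto simp: resid_3)
qed

text \<open>Irreducibility of T^2 + 1 in the form needed for remainders: u + v T with a common root
  gives u^2 + v^2 = 0, and mod 3 only the trivial solution exists.\<close>

lemma resid_sum_two_squares:
  assumes "u \<in> \<int>" "v \<in> \<int>" "u + v * x = 0" "x ^ 2 = - (1 :: resid)"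
  shows "u = 0 \<and> v = 0"
proof -
  obtain i j where ij: "u = of_int i" "v = of_int j" using assms by (auto elim!: Ints_cases)
  have "u = - (v * x)" using assms(3) by (simp add: add_eq_0_iff2)
  hence "u ^ 2 + v ^ 2 = v ^ 2 * (x ^ 2 + 1)" by (simp add: power_mult_distrib algebra_simps)
  also have "\<dots> = 0" using assms(4) by simp
  finally have "of_int (i ^ 2 + j ^ 2) = (0 :: resid)" by (simp add: ij)
  hence "3 dvd i ^ 2 + j ^ 2" by (simp only: resid_of_int_eq_0_iff)
  moreover define a r b s where "a = i div 3" and "r = i mod 3" and "b = j div 3" and "s = j mod 3"
  have ri: "i = 3 * a + r" "j = 3 * b + s" by (simp_all add: a_def r_def b_def s_def)
  hence "i ^ 2 + j ^ 2 = 3 * (3 * a ^ 2 + 2 * a * r + 3 * b ^ 2 + 2 * b * s) + (r ^ 2 + s ^ 2)"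
    by (simp add: power2_eq_square algebra_simps)
  ultimately have "3 dvd r ^ 2 + s ^ 2" by (metis dvd_add_right_iff dvd_triv_left)
  moreover have "r = 0 \<or> r = 1 \<or> r = 2" "s = 0 \<or> s = 1 \<or> s = 2"
    unfolding r_def s_def by presburger+
  ultimately have "r = 0 \<and> s = 0" by auto
  hence "3 dvd i \<and> 3 dvd j" using ri by simp
  thus ?thesis unfolding ij resid_of_int_eq_0_iff by auto
qed

text \<open>With multiplicity, the roots of the reduced polynomial are the residues of the
  conjugates that are integral after division by w, so counting roots counts embeddings. The three
  parts select the roots with T^b nonzero, with T^b = -1 and with T^(2b) = -1; the last gains its 2
  from the degree of T^2 + 1.\<close>

lemma embedding_count:
  fixes a :: "nat \<Rightarrow> complex" and w :: complex
  assumes char: "(\<Prod>i<n. [:- a i, 1:]) = map_poly of_rat q"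
    and w: "w ^ b = 3 ^ k" and cop: "coprime k b" and b: "b > 0"
  shows "b dvd card {i. i < n \<and> a i / w \<in> val_ring \<and> res (a i / w) \<noteq> 0}"
    and "b dvd card {i. i < n \<and> a i / w \<in> val_ring \<and> res (a i / w) ^ b = - 1}"
    and "2 * b dvd card {i. i < n \<and> a i / w \<in> val_ring \<and> res (a i / w) ^ (2 * b) = - 1}"
proof -
  define S where "S = {i. i < n \<and> a i / w \<in> val_ring}"
  define \<rho> where "\<rho> i = res (a i / w)" for i
  obtain c r Q where Q: "c \<noteq> 0" "Q \<noteq> 0" "\<forall>i. coeff Q i \<in> \<int>"
    "smult c (\<Prod>i\<in>S. [:- \<rho> i, 1:]) = monom 1 r * pcompose Q (monom 1 b)" (is "_ = ?P")
    using residue_char_poly[OF char w cop b] unfolding S_def \<rho>_def by blast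
  have fin: "finite S" by (simp add: S_def)
  have "proots ?P = (\<Sum>i\<in>S. {#\<rho> i#})"
    unfolding Q(4)[symmetric] using Q(1) by (subst proots_smult, simp, subst proots_prod) auto
  also have "\<dots> = image_mset \<rho> (mset_set S)"
    using fin by (induction S) auto
  finally have pr: "proots ?P = image_mset \<rho> (mset_set S)" .
  have card: "size (filter_mset R (proots ?P)) = card {i \<in> S. R (\<rho> i)}" for R
    unfolding pr using fin by (simp add: filter_mset_image_mset)
  have "degree ?P = card S"
    unfolding Q(4)[symmetric] using Q(1) by (simp add: degree_prod_eq_sum_degree)
  hence split: "size (proots ?P) = degree ?P" by (simp add: pr)
  show "b dvd card {i. i < n \<and> a i / w \<in> val_ring \<and> res (a i / w) \<noteq> 0}"
    using dvd_card_nonzero_roots[OF b Q(2) split] unfolding card by (simp add: S_def \<rho>_def conj_ac)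
  have "b * degree [:1, 1 :: resid:] dvd size (filter_mset (\<lambda>x. poly [:1, 1:] (x ^ b) = 0) (proots ?P))"
  proof (rule dvd_card_roots_power[OF b, where F = "{Q. \<forall>i. coeff Q i \<in> \<int>}"])
    fix Q :: "resid poly" and x assume h: "Q \<in> {Q. \<forall>i. coeff Q i \<in> \<int>}" "poly Q x = 0" "poly [:1, 1:] x = 0"
    then obtain Q1 u where Q1: "Q = [:1, 1:] * Q1 + [:u:]" "\<forall>i. coeff Q1 i \<in> \<int>"
      using Ints_poly_div_linear[of Q] by auto
    have "poly Q x = poly [:1, 1:] x * poly Q1 x + u"
      unfolding Q1(1) by (simp add: algebra_simps)
    hence "u = 0" using h(2,3) by simp
    thus "\<exists>Q1\<in>{Q. \<forall>i. coeff Q i \<in> \<int>}. Q = [:1, 1:] * Q1" using Q1 by auto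
  qed (use Q split in auto)
  moreover have "poly [:1, 1:] y = 0 \<longleftrightarrow> y = - 1" for y :: resid
    by (auto simp: add_eq_0_iff add.commute)
  ultimately show "b dvd card {i. i < n \<and> a i / w \<in> val_ring \<and> res (a i / w) ^ b = - 1}"
    unfolding card by (simp add: S_def \<rho>_def conj_ac)
  have "b * degree [:1, 0, 1 :: resid:] dvd size (filter_mset (\<lambda>x. poly [:1, 0, 1:] (x ^ b) = 0) (proots ?P))"
  proof (rule dvd_card_roots_power[OF b, where F = "{Q. \<forall>i. coeff Q i \<in> \<int>}"])
    fix Q :: "resid poly" and x assume h: "Q \<in> {Q. \<forall>i. coeff Q i \<in> \<int>}" "poly Q x = 0" "poly [:1, 0, 1:] x = 0"
    then obtain Q1 u v where Q1: "Q = [:1, 0, 1:] * Q1 + [:u, v:]" "\<forall>i. coeff Q1 i \<in> \<int>" "u \<in> \<int>" "v \<in> \<int>"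
      using Ints_poly_div_quadratic[of Q] by auto
    have x2: "x ^ 2 = - 1" using h(3) by (simp add: power2_eq_square add_eq_0_iff)
    have "poly Q x = poly [:1, 0, 1:] x * poly Q1 x + (u + v * x)"
      unfolding Q1(1) by (simp add: algebra_simps)
    hence "u + v * x = 0" using h(2,3) by simp
    hence "u = 0 \<and> v = 0" using resid_sum_two_squares[OF Q1(3,4) _ x2] by blast
    thus "\<exists>Q1\<in>{Q. \<forall>i. coeff Q i \<in> \<int>}. Q = [:1, 0, 1:] * Q1" using Q1 by auto
  qed (use Q split in auto)
  moreover have "poly [:1, 0, 1:] (y ^ b) = 0 \<longleftrightarrow> y ^ (2 * b) = - 1" for y :: resid
    by (auto simp: add_eq_0_iff mult_2 power_add)
  ultimately show "2 * b dvd card {i. i < n \<and> a i / w \<in> val_ring \<and> res (a i / w) ^ (2 * b) = - 1}"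
    unfolding card by (simp add: S_def \<rho>_def conj_ac mult_2 mult_2_right)
qed

section \<open>Divisibility of the degrees\<close>

lemma val_ratio_unit:
  assumes t: "t \<noteq> 0" "A / t \<in> val_ring" "B / t \<in> val_ring" and B: "res (B / t) \<noteq> 0"
  shows "A / B \<in> val_ring" "res (A / B) = res (A / t) / res (B / t)"
proof -
  have i: "B / t \<noteq> 0" "inverse (B / t) \<in> val_ring"
    using t B by (auto simp: res_eq_0_iff val_ideal_def)
  have AB: "A / B = A / t * inverse (B / t)" using i t by (simp add: field_simps)
  show in1: "A / B \<in> val_ring" unfolding AB using t i by (intro val_ring_mult) auto
  have "A / B * (B / t) = A / t" using i by (simp add: field_simps)
  hence "res (A / B) * res (B / t) = res (A / t)" using res_mult[OF in1 t(3)] by metis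
  thus "res (A / B) = res (A / t) / res (B / t)" using B by (simp add: field_simps)
qed

text \<open>Here \<open>A / B\<close> lies outside the ring unless \<open>B\<close> is 0, where
  division returns 0. Either way an embedding with vanishing denominator falls out of the classes,
  which ask for a nonzero residue.\<close>

lemma val_ratio_nonunit:
  assumes t: "t \<noteq> 0" "A / t \<in> val_ring" "B / t \<in> val_ring"
    and B: "res (B / t) = 0" and A: "res (A / t) \<noteq> 0" and AB: "A / B \<in> val_ring"
  shows "res (A / B) = 0"
proof (cases "B = 0")
  case False
  hence "A / B * (B / t) = A / t" by (simp add: field_simps)
  hence "res (A / B) * res (B / t) = res (A / t)" using res_mult[OF AB t(3)] by metis
  thus ?thesis using A B by simp
qed simp

text \<open>Divisibility is total, so one coordinate divides the other two. Dividing by it makes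
  that coordinate 1.\<close>

lemma exists_max_val:
  assumes "(X, Y, Z) \<noteq> (0, 0, 0)"
  shows "\<exists>t. t \<noteq> 0 \<and> X / t \<in> val_ring \<and> Y / t \<in> val_ring \<and> Z / t \<in> val_ring
    \<and> \<not> (res (X / t) = 0 \<and> res (Y / t) = 0 \<and> res (Z / t) = 0)"
proof -
  have two: "\<exists>t\<in>{A, B}. (t \<noteq> 0 \<or> A = 0 \<and> B = 0) \<and> A / t \<in> val_ring \<and> B / t \<in> val_ring" for A B
  proof (cases "A = 0 \<or> B = 0")
    case True
    thus ?thesis by (cases "A = 0") auto
  next
    case False
    have "A / B \<in> val_ring \<or> B / A \<in> val_ring" using val_ring_total[of "A / B"] by simp
    thus ?thesis using False by auto
  qed
  obtain s where s: "s \<in> {X, Y}" "s \<noteq> 0 \<or> X = 0 \<and> Y = 0" "X / s \<in> val_ring" "Y / s \<in> val_ring"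
    using two[of X Y] by blast
  obtain t where t: "t \<in> {s, Z}" "t \<noteq> 0 \<or> s = 0 \<and> Z = 0" "s / t \<in> val_ring" "Z / t \<in> val_ring"
    using two[of s Z] by blast
  have t0: "t \<noteq> 0" using s t assms by auto
  have "X / t \<in> val_ring \<and> Y / t \<in> val_ring"
  proof (cases "s = 0")
    case False
    have "X / t = X / s * (s / t)" "Y / t = Y / s * (s / t)" using False by simp_all
    thus ?thesis using s t by (metis val_ring_mult)
  qed (use s in auto)
  moreover have "\<not> (res (X / t) = 0 \<and> res (Y / t) = 0 \<and> res (Z / t) = 0)"
    using s(1) t(1) t0 by auto
  ultimately show ?thesis using t0 t by blast
qed

lemma finite_M3 [simp]: "finite (M3 m)"
  by (rule finite_subset[of _ "{..m} \<times> {..m} \<times> {..m}"]) (auto simp: M3_def)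

text \<open>The residues 1, 3, 9 are the values of w^0, w^m, w^(2m), by which the scaling divides
  the corner coefficients; each quotient is 1 mod 3. The 9 outweighs the divisor of every other
  monomial.\<close>

definition corner_congruences :: "nat \<Rightarrow> (expo \<Rightarrow> int) \<Rightarrow> bool" where
  "corner_congruences m c \<longleftrightarrow> (\<exists>d. c (m, 0, 0) = 3 * d + 1) \<and> (\<exists>d. c (0, m, 0) = 9 * d + 3) \<and>
     (\<exists>d. c (0, 0, m) = 27 * d + 9) \<and>
     (\<forall>e\<in>M3 m. e \<noteq> (m, 0, 0) \<and> e \<noteq> (0, m, 0) \<and> e \<noteq> (0, 0, m) \<longrightarrow> 9 dvd c e)"

text \<open>Otherwise the inverse of \<open>w\<close> would be integral, and with it its m-th power
  1/3.\<close>

lemma val_root_3: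
  assumes "w ^ m = (3 :: complex)" and m: "m \<ge> 1"
  shows "w \<in> val_ring" "res w = 0"
proof -
  show w: "w \<in> val_ring"
  proof (rule ccontr)
    assume "w \<notin> val_ring"
    hence "inverse w \<in> val_ring" using val_ring_total by blast
    hence "inverse w ^ m \<in> val_ring" by simp
    thus False using assms val_ring_props(2) by (simp add: power_inverse)
  qed
  have "res w ^ m = res 3" using w assms by (simp flip: res_power)
  also have "\<dots> = 0" by (simp add: res_eq_0_iff)
  finally show "res w = 0" by (simp add: power_eq_0_iff)
qed

text \<open>The powers of \<open>w\<close> absorb the weights $0, 1/m, 2/m$ of the variables, so that only the three
  corner monomials survive in the residue field.\<close>

lemma residue_fermat:
  fixes w x y z t :: complex
  assumes m: "m \<ge> 1" and c: "corner_congruences m c" and w: "w ^ m = 3" and F: "homF m c x y z = 0"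
    and t: "t \<noteq> 0" "x / t \<in> val_ring" "(w * y) / t \<in> val_ring" "(w ^ 2 * z) / t \<in> val_ring"
  shows "res (x / t) ^ m + res ((w * y) / t) ^ m + res ((w ^ 2 * z) / t) ^ m = 0"
proof -
  have w0: "w \<noteq> 0" using w m by (cases "w = 0") (auto simp: power_0_left)
  note wv = val_root_3[OF w m]
  define X Y Z where "X = x / t" and "Y = (w * y) / t" and "Z = (w ^ 2 * z) / t"
  have V: "X \<in> val_ring" "Y \<in> val_ring" "Z \<in> val_ring" using t by (auto simp: X_def Y_def Z_def)
  \<comment> \<open>Coefficients of F after the substitution y = Y / w, z = Z / w^2, with the common
    factor t^m left out.\<close>
  define d where "d = (\<lambda>(i, j, k). of_int (c (i, j, k)) / w ^ (j + 2 * k))"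
  define T where "T = (\<lambda>(i, j, k). d (i, j, k) * (X ^ i * Y ^ j * Z ^ k))"
  have Tsum: "(\<Sum>e\<in>M3 m. T e) = 0"
  proof -
    have "homF m c x y z = (\<Sum>e\<in>M3 m. t ^ m * T e)"
      unfolding homF_def
    proof (rule sum.cong, simp, clarify)
      fix i j k assume "(i, j, k) \<in> M3 m"
      hence e: "m = i + j + k" by (simp add: M3_def)
      have "x = t * X" "y = t * Y / w" "z = t * Z / w ^ 2" using t(1) w0 by (auto simp: X_def Y_def Z_def)
      thus "of_int (c (i, j, k)) * x ^ i * y ^ j * z ^ k = t ^ m * T (i, j, k)"
        using w0 unfolding e T_def d_def
        by (simp add: power_mult_distrib power_divide power_add mult_ac flip: power_mult)
    qed
    thus ?thesis using F t(1) by (simp flip: sum_distrib_left)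
  qed
  have corner1: "d (m, 0, 0) \<in> val_ring \<and> res (d (m, 0, 0)) = 1"
  proof -
    obtain a where "c (m, 0, 0) = 3 * a + 1" using c by (auto simp: corner_congruences_def)
    hence "d (m, 0, 0) = of_int (3 * a + 1)" by (simp add: d_def)
    thus ?thesis by (simp only: res_of_int val_ring_of_int) (simp add: resid_3)
  qed
  have corner2: "d (0, m, 0) \<in> val_ring \<and> res (d (0, m, 0)) = 1"
  proof -
    obtain a where "c (0, m, 0) = 9 * a + 3" using c by (auto simp: corner_congruences_def)
    hence "d (0, m, 0) = of_int (3 * a + 1)" by (simp add: d_def w field_simps)
    thus ?thesis by (simp only: res_of_int val_ring_of_int) (simp add: resid_3)
  qed
  have corner3: "d (0, 0, m) \<in> val_ring \<and> res (d (0, 0, m)) = 1"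
  proof -
    obtain a where "c (0, 0, m) = 27 * a + 9" using c by (auto simp: corner_congruences_def)
    moreover have "w ^ (2 * m) = 9" using w by (simp add: mult_2 power_add)
    ultimately have "d (0, 0, m) = of_int (3 * a + 1)" by (simp add: d_def field_simps)
    thus ?thesis by (simp only: res_of_int val_ring_of_int) (simp add: resid_3)
  qed
  have other: "d e \<in> val_ring \<and> res (d e) = 0"
    if e: "e \<in> M3 m" "e \<noteq> (m, 0, 0)" "e \<noteq> (0, m, 0)" "e \<noteq> (0, 0, m)" for e
  proof -
    obtain i j k where ijk: "e = (i, j, k)" by (cases e)
    have "9 dvd c e" using e c by (auto simp: corner_congruences_def)
    then obtain a where a: "c e = 9 * a" by blast
    have "k \<noteq> m" using e by (auto simp: ijk M3_def)
    \<comment> \<open>Weight 2m is reached only at (0, 0, m), so 9 divided by w^(j + 2k) keeps a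
      positive power of w and reduces to 0.\<close>
    hence lt: "j + 2 * k < 2 * m" using e(1) by (simp add: ijk M3_def)
    then obtain l where l: "2 * m = (j + 2 * k) + Suc l" by (metis less_iff_Suc_add add_Suc_right)
    have "w ^ (2 * m) = 9" using w by (simp add: mult_2 power_add)
    hence nine: "w ^ (j + 2 * k) * w ^ Suc l = 9" unfolding l power_add .
    have "d e = of_int a * 9 / w ^ (j + 2 * k)" by (simp add: d_def ijk a[unfolded ijk])
    hence "d e = of_int a * w ^ Suc l" unfolding nine[symmetric] using w0 by simp
    thus ?thesis using wv by (simp add: res_mult res_power del: power_Suc)
  qed
  have dV: "d e \<in> val_ring" if "e \<in> M3 m" for e
    using that other[of e] corner1 corner2 corner3 by metis
  have TV: "T e \<in> val_ring" if "e \<in> M3 m" for e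
    using dV[OF that] V by (cases e) (simp add: T_def)
  define E where "E = {(m, 0, 0), (0, m, 0), (0, 0, m)}"
  have E: "E \<subseteq> M3 m" by (auto simp: E_def M3_def)
  have "0 = res (\<Sum>e\<in>M3 m. T e)" using Tsum by simp
  also have "\<dots> = (\<Sum>e\<in>M3 m. res (T e))" using TV by (rule res_sum)
  also have "\<dots> = (\<Sum>e\<in>E. res (T e))"
  proof (rule sum.mono_neutral_right[OF finite_M3 E], clarify)
    fix i j k assume e: "(i, j, k) \<in> M3 m" "(i, j, k) \<notin> E"
    have "d (i, j, k) \<in> val_ring \<and> res (d (i, j, k)) = 0"
      using e by (intro other) (auto simp: E_def)
    thus "res (T (i, j, k)) = 0" using V by (simp add: T_def res_mult)
  qed
  also have "\<dots> = res (T (m, 0, 0)) + res (T (0, m, 0)) + res (T (0, 0, m))"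
    using m by (simp add: E_def)
  also have "\<dots> = res X ^ m + res Y ^ m + res Z ^ m"
    using corner1 corner2 corner3 V by (simp add: T_def res_mult res_power)
  finally show ?thesis by (simp add: X_def Y_def Z_def)
qed

context
  fixes L h
  assumes L: "is_subfield L" and h: "rational_embedding L h"
begin

lemma emb_0: "h 0 = 0"
proof -
  have "h (of_rat 0 * 1) = of_rat 0 * h 1"
    using h L unfolding rational_embedding_def is_subfield_def by blast
  thus ?thesis by simp
qed

lemma emb_mult: "a \<in> L \<Longrightarrow> b \<in> L \<Longrightarrow> h (a * b) = h a * h b"
  using h by (simp add: rational_embedding_def)

lemma emb_power: "a \<in> L \<Longrightarrow> h (a ^ n) = h a ^ n"
  using h L by (induction n) (auto simp: rational_embedding_def subfield_power)

lemma emb_eq_0: "a \<in> L \<Longrightarrow> h a = 0 \<Longrightarrow> a = 0"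
  using emb_mult[of a "inverse a"] h L
  by (cases "a = 0") (auto simp: rational_embedding_def is_subfield_def simp del: mult_eq_0_iff)

lemma subfield_divide: "a \<in> L \<Longrightarrow> b \<in> L \<Longrightarrow> a / b \<in> L"
  using L by (cases "b = 0") (auto simp: is_subfield_def divide_inverse)

lemma emb_divide:
  assumes "a \<in> L" "b \<in> L"
  shows "h (a / b) = h a / h b"
proof (cases "b = 0")
  case False
  hence "h (a / b) * h b = h a" using emb_mult[of "a / b" b] assms subfield_divide by simp
  moreover have "h b \<noteq> 0" using emb_eq_0 False assms by blast
  ultimately show ?thesis by (simp add: field_simps)
qed (simp add: emb_0)

lemma emb_sum: "(\<And>i. i \<in> A \<Longrightarrow> f i \<in> L) \<Longrightarrow> sum f A \<in> L \<and> h (sum f A) = (\<Sum>i\<in>A. h (f i))"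
proof (induction A rule: infinite_finite_induct)
  case (insert x F)
  thus ?case using h L by (auto simp: rational_embedding_def is_subfield_def)
qed (use L emb_0 in \<open>auto simp: is_subfield_def\<close>)

text \<open>The coefficients are integers, hence fixed by \<open>h\<close>, so conjugate points lie
  on the same curve.\<close>

lemma emb_homF:
  assumes "x \<in> L" "y \<in> L" "z \<in> L"
  shows "h (homF m c x y z) = homF m c (h x) (h y) (h z)"
proof -
  have i: "of_int k = (of_rat (of_int k) :: complex)" for k by simp
  have cl: "a \<in> L \<Longrightarrow> b \<in> L \<Longrightarrow> a * b \<in> L" for a b using L by (auto simp: is_subfield_def)
  have sc: "h (of_int k * a) = of_int k * h a" "of_int k * a \<in> L" if "a \<in> L" for k a
    using h that subfield_of_rat[OF L, of "of_int k"] cl unfolding i rational_embedding_def by blast+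
  have "h (case e of (i, j, k) \<Rightarrow> of_int (c (i, j, k)) * x ^ i * y ^ j * z ^ k)
      = (case e of (i, j, k) \<Rightarrow> of_int (c (i, j, k)) * h x ^ i * h y ^ j * h z ^ k) \<and>
      (case e of (i, j, k) \<Rightarrow> of_int (c (i, j, k)) * x ^ i * y ^ j * z ^ k) \<in> L" for e
    using assms subfield_power[OF L] by (cases e) (simp add: mult.assoc sc emb_mult emb_power cl)
  thus ?thesis unfolding homF_def by (subst emb_sum[THEN conjunct2]) auto
qed

end

lemma degree_divisible:
  assumes m: "m \<ge> 1" and c: "corner_congruences m c"
    and L: "is_subfield L" and deg: "field_degree L n"
    and xyz: "x \<in> L" "y \<in> L" "z \<in> L" "(x, y, z) \<noteq> (0, 0, 0)" and F: "homF m c x y z = 0"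
  shows "m dvd n"
proof -
  obtain h where h: "\<And>i. i < n \<Longrightarrow> rational_embedding L (h i)"
    and char: "\<And>a. a \<in> L \<Longrightarrow> \<exists>q. (\<Prod>i<n. [:- h i a, 1:]) = map_poly of_rat q"
    using field_embeddings[OF L deg] by blast
  define w :: complex where "w = of_real (root m 3)"
  have "root m 3 ^ m = 3" using m by (intro real_root_pow_pos2) auto
  hence w: "w ^ m = 3" unfolding w_def by (metis of_real_numeral of_real_power)
  have w0: "w \<noteq> 0" using w m by (cases "w = 0") (auto simp: power_0_left)
  \<comment> \<open>For XY nonzero it is enough that X/Y be a unit. For X = 0 a unit Y/Z would not
    do, as all three residues may be nonzero; the m-th power -1 singles out the class, and likewise
    for Y = 0.\<close>
  define E1 where "E1 = {i. i < n \<and> h i (x / y) / w \<in> val_ring \<and> res (h i (x / y) / w) \<noteq> 0}"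
  define E2 where "E2 = {i. i < n \<and> h i (y / z) / w \<in> val_ring \<and> res (h i (y / z) / w) ^ m = - 1}"
  define E3 where "E3 = {i. i < n \<and> h i (x / z) / w ^ 2 \<in> val_ring \<and> res (h i (x / z) / w ^ 2) ^ m = - 1}"
  have q: "x / y \<in> L" "y / z \<in> L" "x / z \<in> L"
    using xyz L by (auto simp: is_subfield_def divide_inverse)
  have d1: "m dvd card E1"
    using embedding_count(1)[of "\<lambda>i. h i (x / y)" n _ w m 1] char[OF q(1)] w m by (auto simp: E1_def)
  have d2: "m dvd card E2"
    using embedding_count(2)[of "\<lambda>i. h i (y / z)" n _ w m 1] char[OF q(2)] w m by (auto simp: E2_def)
  have d3: "m dvd card E3"
  proof (cases "even m")
    case True
    \<comment> \<open>Here w^2 is an l-th root of 3, so only b = l is available; the condition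
      T^(2l) = -1 is the one that yields 2l. For odd m, w^2 is an m-th root of 9 with 2 prime to
      m.\<close>
    then obtain l where l: "m = 2 * l" by blast
    have "(w ^ 2) ^ l = 3 ^ 1" using w by (simp add: l flip: power_mult)
    thus ?thesis using embedding_count(3)[of "\<lambda>i. h i (x / z)" n _ "w ^ 2" l 1] char[OF q(3)] m
      by (auto simp: E3_def l)
  next
    case False
    have "(w ^ 2) ^ m = 3 ^ 2" using w by (metis mult.commute power_mult)
    moreover have "coprime 2 m" using False by simp
    ultimately show ?thesis using embedding_count(2)[of "\<lambda>i. h i (x / z)" n _ "w ^ 2" m 2] char[OF q(3)] m
      by (auto simp: E3_def)
  qed
  have part: "(i \<in> E1 \<and> i \<notin> E2 \<and> i \<notin> E3) \<or> (i \<notin> E1 \<and> i \<in> E2 \<and> i \<notin> E3) \<or> (i \<notin> E1 \<and> i \<notin> E2 \<and> i \<in> E3)"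
    if i: "i < n" for i
  proof -
    note hi = h[OF i]
    define X Y Z where "X = h i x" and "Y = w * h i y" and "Z = w ^ 2 * h i z"
    have "(X, Y, Z) \<noteq> (0, 0, 0)"
      using emb_eq_0[OF L hi] xyz w0 by (auto simp: X_def Y_def Z_def)
    then obtain t where t: "t \<noteq> 0" "X / t \<in> val_ring" "Y / t \<in> val_ring" "Z / t \<in> val_ring"
      and nz: "\<not> (res (X / t) = 0 \<and> res (Y / t) = 0 \<and> res (Z / t) = 0)"
      using exists_max_val by blast
    have "homF m c (h i x) (h i y) (h i z) = 0"
      using emb_homF[OF L hi xyz(1-3), of m c] F emb_0[OF L hi] by simp
    hence sum: "res (X / t) ^ m + res (Y / t) ^ m + res (Z / t) ^ m = 0"
      using residue_fermat[OF m c w] t unfolding X_def Y_def Z_def by blast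
    have r1: "h i (x / y) / w = X / Y" using w0 by (simp add: emb_divide[OF L hi xyz(1,2)] X_def Y_def)
    have r2: "h i (y / z) / w = Y / Z"
      using w0 by (simp add: emb_divide[OF L hi xyz(2,3)] Y_def Z_def power2_eq_square)
    have r3: "h i (x / z) / w ^ 2 = X / Z" by (simp add: emb_divide[OF L hi xyz(1,3)] X_def Z_def)
    define \<xi> \<eta> \<zeta> where "\<xi> = res (X / t)" and "\<eta> = res (Y / t)" and "\<zeta> = res (Z / t)"
    have sum': "\<xi> ^ m + \<eta> ^ m + \<zeta> ^ m = 0" and nz': "\<not> (\<xi> = 0 \<and> \<eta> = 0 \<and> \<zeta> = 0)"
      using sum nz by (auto simp: \<xi>_def \<eta>_def \<zeta>_def)
    have pw: "a ^ m = 0 \<longleftrightarrow> a = 0" for a :: resid using m by (auto simp: power_0_left)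
    \<comment> \<open>If two residues vanish, the Fermat equation kills the third. This makes the
      three classes disjoint and exhaustive.\<close>
    have two: "\<not> (\<xi> = 0 \<and> \<eta> = 0)" "\<not> (\<xi> = 0 \<and> \<zeta> = 0)" "\<not> (\<eta> = 0 \<and> \<zeta> = 0)"
      using sum' nz' pw[of \<xi>] pw[of \<eta>] pw[of \<zeta>] m by (auto simp: power_0_left)
    have neg1: "a ^ m = - 1 \<Longrightarrow> a \<noteq> 0" for a :: resid using m by (auto simp: power_0_left)
    have quot: "(a / b) ^ m = - 1 \<longleftrightarrow> a ^ m + b ^ m = 0" if "b \<noteq> 0" for a b :: resid
      using that by (simp add: power_divide divide_eq_eq add_eq_0_iff2)
    have e1: "i \<in> E1 \<longleftrightarrow> \<xi> \<noteq> 0 \<and> \<eta> \<noteq> 0"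
    proof (cases "\<eta> = 0")
      case True
      hence "\<xi> \<noteq> 0" using two by simp
      thus ?thesis using True val_ratio_nonunit[OF t(1,2,3)] by (auto simp: E1_def r1 \<xi>_def \<eta>_def)
    next
      case False
      thus ?thesis using val_ratio_unit[OF t(1,2,3)] i by (auto simp: E1_def r1 \<xi>_def \<eta>_def)
    qed
    have e2: "i \<in> E2 \<longleftrightarrow> \<xi> = 0"
    proof (cases "\<zeta> = 0")
      case True
      hence n0: "\<eta> \<noteq> 0" "\<xi> \<noteq> 0" using two by simp_all
      thus ?thesis using True val_ratio_nonunit[OF t(1,3,4)] neg1 by (auto simp: E2_def r2 \<zeta>_def \<eta>_def)
    next
      case False
      hence "i \<in> E2 \<longleftrightarrow> \<eta> ^ m + \<zeta> ^ m = 0"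
        using val_ratio_unit[OF t(1,3,4)] i quot by (auto simp: E2_def r2 \<zeta>_def \<eta>_def)
      also have "\<dots> \<longleftrightarrow> \<xi> ^ m = 0" using sum' by (metis add.assoc add_0 add.right_neutral)
      finally show ?thesis using pw by simp
    qed
    have e3: "i \<in> E3 \<longleftrightarrow> \<eta> = 0"
    proof (cases "\<zeta> = 0")
      case True
      hence n0: "\<eta> \<noteq> 0" "\<xi> \<noteq> 0" using two by simp_all
      thus ?thesis using True val_ratio_nonunit[OF t(1,2,4)] neg1 by (auto simp: E3_def r3 \<zeta>_def \<xi>_def)
    next
      case False
      hence "i \<in> E3 \<longleftrightarrow> \<xi> ^ m + \<zeta> ^ m = 0"
        using val_ratio_unit[OF t(1,2,4)] i quot by (auto simp: E3_def r3 \<zeta>_def \<xi>_def)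
      also have "\<dots> \<longleftrightarrow> \<eta> ^ m = 0" using sum' by (metis add.assoc add.commute add_0)
      finally show ?thesis using pw by simp
    qed
    show ?thesis using e1 e2 e3 two by blast
  qed
  have fin: "finite E1" "finite E2" "finite E3" by (auto simp: E1_def E2_def E3_def)
  have "{..<n} = (E1 \<union> E2) \<union> E3" using part by (auto simp: E1_def E2_def E3_def)
  hence "n = card ((E1 \<union> E2) \<union> E3)" by (metis card_lessThan)
  also have "\<dots> = card (E1 \<union> E2) + card E3"
    using fin part by (intro card_Un_disjoint) (auto simp: E1_def E2_def E3_def)
  also have "card (E1 \<union> E2) = card E1 + card E2"
    using fin part by (intro card_Un_disjoint) (auto simp: E1_def E2_def E3_def)
  finally show ?thesis using d1 d2 d3 by simp
qed

section \<open>Index and density\<close>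

definition rat_eval :: "complex \<Rightarrow> rat poly \<Rightarrow> complex" where
  "rat_eval x p = poly (map_poly of_rat p) x"

lemma rat_eval_add: "rat_eval x (p + q) = rat_eval x p + rat_eval x q"
  and rat_eval_uminus: "rat_eval x (- p) = - rat_eval x p"
  and rat_eval_mult: "rat_eval x (p * q) = rat_eval x p * rat_eval x q"
  and rat_eval_1: "rat_eval x 1 = 1" and rat_eval_0: "rat_eval x 0 = 0"
proof -
  interpret mp: map_poly_comm_ring_hom "of_rat :: rat \<Rightarrow> complex" ..
  show "rat_eval x (p + q) = rat_eval x p + rat_eval x q"
    "rat_eval x (- p) = - rat_eval x p"
    "rat_eval x (p * q) = rat_eval x p * rat_eval x q"
    "rat_eval x 1 = 1" "rat_eval x 0 = 0"
    by (simp_all add: rat_eval_def mp.hom_add mp.hom_uminus mp.hom_mult)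
qed

lemma rat_eval_sum:
  assumes "degree p < d"
  shows "rat_eval x p = (\<Sum>i<d. of_rat (coeff p i) * x ^ i)"
proof -
  have "rat_eval x p = (\<Sum>i\<le>degree p. of_rat (coeff p i) * x ^ i)"
    by (simp add: rat_eval_def poly_altdef coeff_map_poly degree_map_poly)
  also have "\<dots> = (\<Sum>i<d. of_rat (coeff p i) * x ^ i)"
    using assms by (intro sum.mono_neutral_left) (auto simp: coeff_eq_0)
  finally show ?thesis .
qed

lemma rat_eval_const: "rat_eval x [:q:] = of_rat q"
  using rat_eval_sum[of "[:q:]" 1 x] by simp

lemma minimal_polynomial:
  assumes p0: "p0 \<noteq> 0" "rat_eval x p0 = 0"
  obtains d p where "d \<ge> 1" "p \<noteq> 0" "degree p = d" "rat_eval x p = 0"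
    "\<And>q. q \<noteq> 0 \<Longrightarrow> rat_eval x q = 0 \<Longrightarrow> d \<le> degree q"
proof -
  define d where "d = (LEAST k. \<exists>p. p \<noteq> 0 \<and> rat_eval x p = 0 \<and> degree p = k)"
  have "\<exists>p. p \<noteq> 0 \<and> rat_eval x p = 0 \<and> degree p = d"
    unfolding d_def by (rule LeastI_ex) (use p0 in blast)
  then obtain p where p: "p \<noteq> 0" "rat_eval x p = 0" "degree p = d" by blast
  have min: "d \<le> degree q" if "q \<noteq> 0" "rat_eval x q = 0" for q
    unfolding d_def by (rule Least_le) (use that in blast)
  have "d \<noteq> 0"
  proof
    assume "d = 0"
    then obtain q where "p = [:q:]" using p(3) degree_eq_zeroE by blast
    thus False using p by (simp add: rat_eval_const)
  qed
  hence "d \<ge> 1" by simp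
  thus ?thesis by (rule that[OF _ p(1,3,2) min])
qed

context
  fixes x :: complex and p :: "rat poly" and d :: nat
  assumes d: "d \<ge> 1" and p: "p \<noteq> 0" "degree p = d" "rat_eval x p = 0"
    and min: "\<And>q. q \<noteq> 0 \<Longrightarrow> rat_eval x q = 0 \<Longrightarrow> d \<le> degree q"
begin

text \<open>Euclidean descent: the remainder r of p by g satisfies r(x) = - (p div g)(x) g(x), so an
  inverse of r(x) yields one of g(x). If r were 0, then p div g would vanish at x in degree below
  the minimum.\<close>

lemma rat_eval_inverse:
  "g \<noteq> 0 \<Longrightarrow> degree g < d \<Longrightarrow> \<exists>u. rat_eval x u * rat_eval x g = 1"
proof (induction "degree g" arbitrary: g rule: less_induct)
  case less
  have g0: "rat_eval x g \<noteq> 0" using min[of g] less.prems by auto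
  show ?case
  proof (cases "degree g = 0")
    case True
    then obtain q where "g = [:q:]" using degree_eq_zeroE by blast
    with less.prems show ?thesis
      by (intro exI[of _ "[:inverse q:]"]) (simp add: rat_eval_const flip: of_rat_mult)
  next
    case False
    define r where "r = p mod g"
    have pe: "p = p div g * g + r" by (simp add: r_def)
    hence eq: "rat_eval x r = - (rat_eval x (p div g) * rat_eval x g)"
      using p(3) by (metis add_eq_0_iff rat_eval_add rat_eval_mult)
    have "r \<noteq> 0"
    proof
      assume "r = 0"
      hence "rat_eval x (p div g) = 0" using eq g0 by (simp add: rat_eval_0)
      moreover have "p div g \<noteq> 0" using pe p(1) \<open>r = 0\<close> by auto
      ultimately have "d \<le> degree (p div g)" by (rule min[rotated])
      moreover have "degree p = degree (p div g) + degree g"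
        using pe \<open>r = 0\<close> \<open>p div g \<noteq> 0\<close> less.prems(1) by (metis add.right_neutral degree_mult_eq)
      ultimately show False using p(2) False by simp
    qed
    moreover have lt: "degree r < degree g"
      using degree_mod_less[of g p] less.prems(1) \<open>r \<noteq> 0\<close> by (simp add: r_def)
    ultimately obtain u where "rat_eval x u * rat_eval x r = 1" using less.hyps[OF lt] less.prems by auto
    hence "rat_eval x (- (u * (p div g))) * rat_eval x g = 1"
      by (simp add: eq rat_eval_uminus rat_eval_mult mult.assoc)
    thus ?thesis by blast
  qed
qed

lemma range_rat_eval: "\<exists>r. degree r < d \<and> rat_eval x q = rat_eval x r"
proof -
  have "q = q div p * p + q mod p" by simp
  hence "rat_eval x q = rat_eval x (q mod p)" using p(3)
    by (metis add_0 mult_zero_right rat_eval_add rat_eval_mult)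
  moreover have "degree (q mod p) < d"
    using degree_mod_less[OF p(1), of q] p(2) d by auto
  ultimately show ?thesis by blast
qed

lemma simple_extension_subfield: "is_subfield (range (rat_eval x))"
proof -
  have "inverse (rat_eval x q) \<in> range (rat_eval x)" if q: "rat_eval x q \<noteq> 0" for q
  proof -
    obtain r where r: "degree r < d" "rat_eval x q = rat_eval x r" using range_rat_eval by blast
    have "r \<noteq> 0" using q r(2) by (auto simp: rat_eval_0)
    then obtain u where "rat_eval x u * rat_eval x r = 1" using rat_eval_inverse r(1) by blast
    hence "inverse (rat_eval x q) = rat_eval x u" unfolding r(2) by (metis inverse_unique mult.commute)
    thus ?thesis by simp
  qed
  thus ?thesis unfolding is_subfield_def
    by (auto simp flip: rat_eval_add rat_eval_mult rat_eval_uminus)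
      (metis rangeI rat_eval_0 rat_eval_1)+
qed

lemma simple_extension_degree: "field_degree (range (rat_eval x)) d"
proof -
  let ?B = "(\<lambda>i. x ^ i) ` {..<d}"
  have deg: "degree (\<Sum>i<d. monom (f i) i :: rat poly) < d" for f
    using d by (intro degree_lessI) (auto simp: coeff_sum)
  have cf: "coeff (\<Sum>i<d. monom (f i) i :: rat poly) i = (if i < d then f i else 0)" for f i
    by (auto simp: coeff_sum)
  have ev: "rat_eval x (\<Sum>i<d. monom (f i) i) = (\<Sum>i<d. of_rat (f i) * x ^ i)" for f
    by (subst rat_eval_sum[OF deg]) (simp add: cf)
  have indep: "f i = 0" if "(\<Sum>i<d. of_rat (f i) * x ^ i) = 0" "i < d" for f :: "nat \<Rightarrow> rat" and i
  proof -
    have "(\<Sum>i<d. monom (f i) i) = 0"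
      using min[of "\<Sum>i<d. monom (f i) i"] deg[of f] that(1) ev[of f] by (metis linorder_not_le)
    thus ?thesis using cf[of f i] that(2) by simp
  qed
  \<comment> \<open>\<open>field_degree\<close> counts a set, so the powers must be distinct; x^i =
    x^j would be a nontrivial relation of degree below d.\<close>
  have inj: "inj_on (\<lambda>i. x ^ i) {..<d}"
  proof (rule inj_onI, rule ccontr)
    fix i j assume ij: "i \<in> {..<d}" "j \<in> {..<d}" "x ^ i = x ^ j" "i \<noteq> j"
    define f :: "nat \<Rightarrow> rat" where "f k = (if k = i then 1 else 0) - (if k = j then 1 else 0)" for k
    have "(\<Sum>k<d. of_rat (f k) * x ^ k) = (\<Sum>k<d. (if k = i then x ^ k else 0) - (if k = j then x ^ k else 0))"
      by (rule sum.cong) (auto simp: f_def)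
    also have "\<dots> = 0" using ij by (simp add: sum_subtractf)
    finally have "f i = 0" using indep ij by blast
    thus False using ij by (simp add: f_def)
  qed
  have sB: "(\<Sum>b\<in>?B. of_rat (q b) * b) = (\<Sum>i<d. of_rat (q (x ^ i)) * x ^ i)" for q :: "complex \<Rightarrow> rat"
    using inj by (simp add: sum.reindex)
  have "?B \<subseteq> range (rat_eval x)"
  proof clarify
    fix i
    have "rat_eval x (monom 1 i) = x ^ i"
      by (simp add: rat_eval_def map_poly_monom poly_monom)
    thus "x ^ i \<in> range (rat_eval x)" by (metis rangeI)
  qed
  moreover have "\<forall>b\<in>?B. q b = 0" if "(\<Sum>b\<in>?B. of_rat (q b) * b) = 0" for q :: "complex \<Rightarrow> rat"
    using indep[of "\<lambda>i. q (x ^ i)"] that unfolding sB by auto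
  moreover have "range (rat_eval x) = {\<Sum>b\<in>?B. of_rat (q b) * b | q :: complex \<Rightarrow> rat. True}"
  proof (intro equalityI subsetI)
    fix y assume "y \<in> range (rat_eval x)"
    then obtain r where r: "degree r < d" "y = rat_eval x r" using range_rat_eval by blast
    define q where "q b = coeff r (the_inv_into {..<d} (\<lambda>i. x ^ i) b)" for b
    have "y = (\<Sum>b\<in>?B. of_rat (q b) * b)"
      unfolding sB r(2) rat_eval_sum[OF r(1)]
      by (rule sum.cong) (auto simp: q_def the_inv_into_f_f[OF inj])
    thus "y \<in> {\<Sum>b\<in>?B. of_rat (q b) * b | q :: complex \<Rightarrow> rat. True}" by blast
  next
    fix y assume "y \<in> {\<Sum>b\<in>?B. of_rat (q b) * b | q :: complex \<Rightarrow> rat. True}"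
    then obtain q :: "complex \<Rightarrow> rat" where "y = (\<Sum>i<d. of_rat (q (x ^ i)) * x ^ i)" using sB by auto
    thus "y \<in> range (rat_eval x)" using ev[of "\<lambda>i. q (x ^ i)"] by (metis rangeI)
  qed
  moreover have "card ?B = d" using inj by (simp add: card_image)
  ultimately show ?thesis unfolding field_degree_def by (intro exI[of _ ?B]) auto
qed

end

lemma rat_eval_in_subfield:
  assumes K: "is_subfield K" and x: "x \<in> K"
  shows "rat_eval x q \<in> K"
proof -
  have "(\<Sum>i\<in>A. of_rat (f i) * x ^ i) \<in> K" if "finite A" for A and f :: "nat \<Rightarrow> rat"
    using that
  proof (induction A)
    case (insert i A)
    thus ?case using K subfield_of_rat[OF K] subfield_power[OF K x] by (auto simp: is_subfield_def)
  qed (use K in \<open>auto simp: is_subfield_def\<close>)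
  thus ?thesis by (subst rat_eval_sum[OF lessI]) blast
qed

section \<open>A new point on the line z = 0\<close>

lemma sum_M3_z0:
  fixes f :: "expo \<Rightarrow> complex"
  assumes "\<And>i j k. k > 0 \<Longrightarrow> f (i, j, k) = 0"
  shows "(\<Sum>e\<in>M3 m. f e) = (\<Sum>i<Suc m. f (i, m - i, 0))"
proof -
  have inj: "inj_on (\<lambda>i. (i, m - i, 0::nat)) {..<Suc m}" by (auto simp: inj_on_def)
  have "(\<Sum>e\<in>M3 m. f e) = (\<Sum>e\<in>(\<lambda>i. (i, m - i, 0)) ` {..<Suc m}. f e)"
  proof (rule sum.mono_neutral_right[OF finite_M3])
    show "\<forall>e\<in>M3 m - (\<lambda>i. (i, m - i, 0)) ` {..<Suc m}. f e = 0"
    proof clarify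
      fix i j k assume e: "(i, j, k) \<in> M3 m" "(i, j, k) \<notin> (\<lambda>i. (i, m - i, 0)) ` {..<Suc m}"
      have "k \<noteq> 0"
      proof
        assume "k = 0"
        hence "(i, j, k) = (i, m - i, 0)" "i < Suc m" using e(1) by (auto simp: M3_def)
        thus False using e(2) by blast
      qed
      thus "f (i, j, k) = 0" using assms by simp
    qed
  qed (auto simp: M3_def)
  also have "\<dots> = (\<Sum>i<Suc m. f (i, m - i, 0))" by (subst sum.reindex[OF inj]) simp
  finally show ?thesis .
qed

text \<open>Any root x of F(T, 1, 0) will do: its degree is at most m, and as (x : 1 : 0) lies on
  the curve it is a multiple of m. Irreducibility of F(T, 1, 0) thus comes out of the
  divisibility.\<close>

lemma degset_self:
  assumes m: "m \<ge> 1" and c: "corner_congruences m c"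
  shows "m \<in> degset m c"
proof -
  define P :: "rat poly" where "P = (\<Sum>i<Suc m. monom (of_int (c (i, m - i, 0))) i)"
  have cP: "coeff P i = (if i < Suc m then of_int (c (i, m - i, 0)) else 0)" for i
    by (auto simp: P_def coeff_sum simp del: sum.lessThan_Suc)
  obtain a where a: "c (m, 0, 0) = 3 * a + 1" using c by (auto simp: corner_congruences_def)
  have "c (m, 0, 0) \<noteq> 0" unfolding a by presburger
  hence lead: "coeff P m \<noteq> 0" by (simp add: cP)
  have dP: "degree P = m"
    by (rule antisym[OF degree_le le_degree[OF lead]]) (auto simp: cP)
  have P0: "P \<noteq> 0" using lead by auto
  have evP: "rat_eval x P = homF m c x 1 0" for x
  proof -
    have "rat_eval x P = (\<Sum>i<Suc m. of_int (c (i, m - i, 0)) * x ^ i)"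
      by (subst rat_eval_sum[of _ "Suc m"]) (simp_all add: dP cP del: sum.lessThan_Suc)
    also have "\<dots> = homF m c x 1 0"
      unfolding homF_def by (subst sum_M3_z0) (auto simp del: sum.lessThan_Suc)
    finally show ?thesis .
  qed
  have evP': "rat_eval x (pderiv P) = homFx m c x 1 0" for x
  proof -
    have "rat_eval x (pderiv P) = (\<Sum>i<m. of_rat (coeff (pderiv P) i) * x ^ i)"
      by (rule rat_eval_sum) (use m in \<open>simp add: degree_pderiv dP\<close>)
    also have "\<dots> = (\<Sum>i<m. of_int (c (Suc i, m - Suc i, 0)) * of_nat (Suc i) * x ^ i)"
      by (rule sum.cong) (auto simp: coeff_pderiv cP of_rat_mult of_rat_add algebra_simps)
    also have "\<dots> = (\<Sum>i<Suc m. of_int (c (i, m - i, 0)) * of_nat i * x ^ (i - 1))"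
      by (subst sum.lessThan_Suc_shift) simp
    also have "\<dots> = homFx m c x 1 0"
      unfolding homFx_def by (subst sum_M3_z0) (auto simp del: sum.lessThan_Suc)
    finally show ?thesis .
  qed
  have "degree (map_poly of_rat P :: complex poly) = m" by (simp add: degree_map_poly dP)
  hence "\<not> constant (poly (map_poly of_rat P :: complex poly))" using m by (simp add: constant_degree)
  then obtain x where x: "rat_eval x P = 0"
    unfolding rat_eval_def using fundamental_theorem_of_algebra by blast
  obtain d p where d: "d \<ge> 1" and p: "p \<noteq> 0" "degree p = d" "rat_eval x p = 0"
    and min: "\<And>q. q \<noteq> 0 \<Longrightarrow> rat_eval x q = 0 \<Longrightarrow> d \<le> degree q"
    using minimal_polynomial[OF P0 x] by blast
  define L where "L = range (rat_eval x)"
  have L: "is_subfield L" and deg: "field_degree L d"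
    unfolding L_def using simple_extension_subfield[OF d p min] simple_extension_degree[OF d p min] by auto
  have "rat_eval x (monom 1 1) = x"
    by (simp add: rat_eval_def map_poly_monom poly_monom)
  hence inL: "x \<in> L" "1 \<in> L" "0 \<in> L" using L unfolding L_def by (metis rangeI, auto simp: is_subfield_def)
  have F: "homF m c x 1 0 = 0" using x evP by simp
  have "m dvd d" by (rule degree_divisible[OF m c L deg inL _ F]) simp
  moreover have "d \<le> m" using min[OF P0 x] dP by simp
  ultimately have dm: "d = m" using d by (auto dest: dvd_imp_le)
  \<comment> \<open>The derivative of F(T, 1, 0) is nonzero of degree m - 1, too small to vanish at
    a number of degree m; so the point is non-singular.\<close>
  have "homFx m c x 1 0 \<noteq> 0"
  proof
    assume "homFx m c x 1 0 = 0"
    moreover have "coeff (pderiv P) (m - 1) \<noteq> 0" using lead m by (simp add: coeff_pderiv)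
    hence "pderiv P \<noteq> 0" by auto
    ultimately have "d \<le> degree (pderiv P)" using min evP' by metis
    thus False using dm m by (simp add: degree_pderiv dP)
  qed
  moreover have "\<not> (\<exists>K t. is_subfield K \<and> K \<subset> L \<and> t \<noteq> 0 \<and> t * x \<in> K \<and> t * 1 \<in> K \<and> t * 0 \<in> K)"
  proof (rule notI, elim exE conjE)
    fix K t assume K: "is_subfield K" "K \<subset> L" "t \<noteq> 0" "t * x \<in> K" "t * 1 \<in> K"
    \<comment> \<open>The coordinate 1 puts t itself into K, so K contains x and hence all of
      L.\<close>
    have "t * x * inverse t \<in> K" using K unfolding is_subfield_def by simp
    moreover have "t * x * inverse t = x" using K(3) by (simp add: field_simps)
    ultimately have "x \<in> K" by simp
    hence "L \<subseteq> K" using rat_eval_in_subfield[OF K(1)] by (auto simp: L_def)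
    thus False using K(2) by blast
  qed
  ultimately have "new_point m c L x 1 0" using inL F by (simp add: new_point_def)
  thus ?thesis unfolding degset_def using L deg dm by blast
qed

lemma curve_index_eq:
  assumes m: "m \<ge> 1" and c: "corner_congruences m c"
  shows "curve_index m c = m"
proof (rule dvd_antisym)
  show "curve_index m c dvd m" unfolding curve_index_def using degset_self[OF m c] by (rule Gcd_dvd)
  show "m dvd curve_index m c" unfolding curve_index_def
  proof (rule Gcd_greatest)
    fix n assume "n \<in> degset m c"
    then obtain L x y z where "is_subfield L" "field_degree L n" "new_point m c L x y z"
      by (auto simp: degset_def)
    thus "m dvd n" using degree_divisible[OF m c] by (auto simp: new_point_def)
  qed
qed

section \<open>Counting coefficient vectors\<close>

lemma family_eq_image:
  "family I B = (\<lambda>g e. if e \<in> I then g e else 0) ` (I \<rightarrow>\<^sub>E ({- int B..int B} - {0}))"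
proof (intro equalityI subsetI)
  fix c assume c: "c \<in> family I B"
  have c1: "c e \<noteq> 0 \<longleftrightarrow> e \<in> I" "\<bar>c e\<bar> \<le> int B" for e
    using c unfolding family_def by blast+
  have "restrict c I \<in> I \<rightarrow>\<^sub>E ({- int B..int B} - {0})"
    using c1 by (auto simp: abs_le_iff) (smt (verit))+
  moreover have "c = (\<lambda>e. if e \<in> I then restrict c I e else 0)"
    by (rule ext) (use c1(1) in \<open>metis restrict_apply'\<close>)
  ultimately show "c \<in> (\<lambda>g e. if e \<in> I then g e else 0) ` (I \<rightarrow>\<^sub>E ({- int B..int B} - {0}))" by blast
next
  fix c assume "c \<in> (\<lambda>g e. if e \<in> I then g e else 0) ` (I \<rightarrow>\<^sub>E ({- int B..int B} - {0}))"
  then obtain g where "g \<in> I \<rightarrow>\<^sub>E ({- int B..int B} - {0})" "c = (\<lambda>e. if e \<in> I then g e else 0)" by blast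
  moreover from this have "g e \<noteq> 0 \<and> \<bar>g e\<bar> \<le> int B" if "e \<in> I" for e
    using that by (auto simp: PiE_iff abs_le_iff)
  ultimately show "c \<in> family I B" by (auto simp: family_def)
qed

lemma card_family:
  assumes "finite I"
  shows "card (family I B) = (2 * B) ^ card I" "finite (family I B)"
proof -
  have "inj_on (\<lambda>g e. if e \<in> I then g e else 0) (I \<rightarrow>\<^sub>E ({- int B..int B} - {0}))"
    by (rule inj_onI, rule PiE_ext, assumption, assumption) metis
  hence "card (family I B) = card (I \<rightarrow>\<^sub>E ({- int B..int B} - {0}))"
    unfolding family_eq_image by (rule card_image)
  also have "\<dots> = card ({- int B..int B} - {0}) ^ card I"
    using assms by (simp add: card_PiE)
  also have "card ({- int B..int B} - {0}) = 2 * B" by (subst card_Diff_singleton) auto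
  finally show "card (family I B) = (2 * B) ^ card I" .
  show "finite (family I B)" unfolding family_eq_image using assms by (intro finite_imageI finite_PiE) auto
qed

theorem theorem1p7:
  fixes m :: nat and I :: "expo set"
  assumes "m \<ge> 1"
    and "{(i, j, 0) | i j. i + j = m} \<union> {(0, 0, m)} \<subseteq> I"
    and "I \<subseteq> M3 m"
  shows "(\<exists>\<delta>::real. \<delta> > 0 \<and>
           (\<forall>\<^sub>F B in sequentially.
              real (card {c \<in> family I B. curve_index m c = m}) \<ge> \<delta> * real (card (family I B))))
         \<and> Gidx {(0, 0, m), (0, m, 0), (m, 0, 0)} = m"
proof
  show "Gidx {(0, 0, m), (0, m, 0), (m, 0, 0)} = m"
    by (simp add: Gidx_def)
  have I: "finite I" using assms(3) finite_M3 finite_subset by blast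
  have corners: "(m, 0, 0) \<in> I" "(0, m, 0) \<in> I" "(0, 0, m) \<in> I" using assms(2) by auto
  define r :: "expo \<Rightarrow> int" where
    "r e = (if e = (m, 0, 0) then 1 else if e = (0, m, 0) then 3 else if e = (0, 0, m) then 9 else 0)" for e
  \<comment> \<open>An injection of a smaller box into the good coefficient vectors: 27 is the
    largest modulus involved, and since r is at most 9, a nonzero g stays nonzero.\<close>
  define \<Phi> where "\<Phi> g = (\<lambda>e. if e \<in> I then 27 * g e + r e else 0)" for g :: "expo \<Rightarrow> int"
  have r: "0 \<le> r e" "r e \<le> 9" for e by (auto simp: r_def)
  have good: "\<Phi> g \<in> {c \<in> family I B. curve_index m c = m}"
    if g: "g \<in> family I ((B - 9) div 27)" and B: "B \<ge> 70" for g B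
  proof -
    have g1: "g e \<noteq> 0 \<longleftrightarrow> e \<in> I" "\<bar>g e\<bar> \<le> int ((B - 9) div 27)" for e
      using g unfolding family_def by blast+
    have "27 * ((B - 9) div 27) + 9 \<le> B" using B by linarith
    hence le: "27 * int ((B - 9) div 27) + 9 \<le> int B" by linarith
    have "\<Phi> g \<in> family I B" unfolding family_def
    proof (clarify, intro conjI allI)
      fix e
      show "\<Phi> g e \<noteq> 0 \<longleftrightarrow> e \<in> I" using g1(1)[of e] r[of e] unfolding \<Phi>_def by auto
      show "\<bar>\<Phi> g e\<bar> \<le> int B" using g1(2)[of e] r[of e] le unfolding \<Phi>_def by auto
    qed
    moreover have "corner_congruences m (\<Phi> g)"
      unfolding corner_congruences_def
    proof (intro conjI ballI impI)
      show "\<exists>d. \<Phi> g (m, 0, 0) = 3 * d + 1"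
        using corners assms(1) by (intro exI[of _ "9 * g (m, 0, 0)"]) (simp add: \<Phi>_def r_def)
      show "\<exists>d. \<Phi> g (0, m, 0) = 9 * d + 3"
        using corners assms(1) by (intro exI[of _ "3 * g (0, m, 0)"]) (simp add: \<Phi>_def r_def)
      show "\<exists>d. \<Phi> g (0, 0, m) = 27 * d + 9"
        using corners assms(1) by (intro exI[of _ "g (0, 0, m)"]) (simp add: \<Phi>_def r_def)
      fix e assume "e \<noteq> (m, 0, 0) \<and> e \<noteq> (0, m, 0) \<and> e \<noteq> (0, 0, m)"
      thus "9 dvd \<Phi> g e" by (simp add: \<Phi>_def r_def)
    qed
    ultimately show ?thesis using curve_index_eq[OF assms(1)] by simp
  qed
  have inj: "inj_on \<Phi> (family I B)" for B
  proof (rule inj_onI, rule ext)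
    fix g g' e assume g: "g \<in> family I B" "g' \<in> family I B" "\<Phi> g = \<Phi> g'"
    show "g e = g' e"
    proof (cases "e \<in> I")
      case True
      thus ?thesis using fun_cong[OF g(3), of e] by (simp add: \<Phi>_def)
    next
      case False
      thus ?thesis using g(1,2) unfolding family_def by (metis (mono_tags, lifting) mem_Collect_eq)
    qed
  qed
  \<comment> \<open>In each of the \<open>card I\<close> coordinates the box shrinks by a factor of
    at most 54, twice the modulus 27 to allow for rounding.\<close>
  define \<delta> :: real where "\<delta> = (1 / 54) ^ card I"
  have "\<delta> * real (card (family I B)) \<le> real (card {c \<in> family I B. curve_index m c = m})"
    if B: "B \<ge> 70" for B
  proof -
    define B' where "B' = (B - 9) div 27"
    \<comment> \<open>Rounding gives 27 B' >= B - 35, so 54 B' >= 2 B - 70, which is at least B from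
      B = 70 on.\<close>
    have "B \<le> 54 * B'" unfolding B'_def using B by linarith
    hence "real B \<le> 54 * real B'" by linarith
    hence le: "1 / 54 * real (2 * B) \<le> real (2 * B')" by simp
    have "\<delta> * real (card (family I B)) = (1 / 54 * real (2 * B)) ^ card I"
      unfolding \<delta>_def card_family(1)[OF I] of_nat_power
      by (rule power_mult_distrib[symmetric])
    also have "\<dots> \<le> real (2 * B') ^ card I" using le by (intro power_mono) auto
    also have "\<dots> = real (card (family I B'))" unfolding card_family(1)[OF I] by simp
    also have "card (family I B') = card (\<Phi> ` family I B')" using inj by (simp add: card_image)
    also have "real (card (\<Phi> ` family I B')) \<le> real (card {c \<in> family I B. curve_index m c = m})"
      using good[OF _ B] card_family(2)[OF I, of B]
      by (intro of_nat_mono card_mono) (auto simp: B'_def)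
    finally show ?thesis .
  qed
  hence "\<forall>\<^sub>F B in sequentially. \<delta> * real (card (family I B)) \<le> real (card {c \<in> family I B. curve_index m c = m})"
    by (auto simp: eventually_sequentially)
  moreover have "\<delta> > 0" by (simp add: \<delta>_def)
  ultimately show "\<exists>\<delta>::real. \<delta> > 0 \<and>
           (\<forall>\<^sub>F B in sequentially.
              real (card {c \<in> family I B. curve_index m c = m}) \<ge> \<delta> * real (card (family I B)))" by blast
qed

end
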